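(* The complex manifold $(\mathbb{H}\setminus\mathbb{R},\ \mathbb{J})$ is biholomorphic to the open subset $\mathcal{Q}^+$ of the quadric $$\mathcal{Q}=\{[Z_0,Z_1,Z_2,Z_3]\in\mathbb{CP}^3: Z_0Z_3=Z_1Z_2\}$$ whose elements satisfy at least one of the following conditions: (i) $Z_0\neq0$ and $Z_2/Z_0\in\mathbb{C}^+$; (ii) $Z_1\neq0$ and $Z_3/Z_1\in\mathbb{C}^+$.
   Context: $\mathbb{H}$ denotes the quaternions and $\mathbb{C}^+=\{x+iy\in\mathbb{C}:y>0\}$. For $q\in\mathbb{H}\setminus\mathbb{R}$ let $I_q=\mathrm{Im}(q)/|\mathrm{Im}(q)|$. Identifying each tangent space $T_q(\mathbb{H}\setminus\mathbb{R})$ with $\mathbb{H}$, the (integrable) complex structure $\mathbb{J}$ on $\mathbb{H}\setminus\mathbb{R}$ is defined by $\mathbb{J}_q\mathbf{v}=I_q\mathbf{v}$ (quaternionic left multiplication). *)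

theory Defs
  imports "HOL-Analysis.Analysis"
begin

section \<open>Complex manifolds\<close>

text \<open>Only used for open \<open>S\<close>, where complex-linear real Frechet differentiability at every point is
  holomorphy in several variables.\<close>

definition holomorphic_vec_on :: "(complex^'n \<Rightarrow> complex^'m) \<Rightarrow> (complex^'n) set \<Rightarrow> bool"
  where "holomorphic_vec_on f S \<longleftrightarrow>
    (\<forall>x\<in>S. \<exists>D. (f has_derivative D) (at x) \<and> (\<forall>c v. D (c *s v) = c *s D v))"

text \<open>A chart is a pair of a domain and a coordinate map; the values of the map outside of the
  domain are irrelevant.\<close>

type_synonym ('p, 'n) chart = "'p set \<times> ('p \<Rightarrow> complex^'n)"

definition is_chart :: "'p topology \<Rightarrow> ('p, 'n::finite) chart \<Rightarrow> bool"
  where "is_chart X = (\<lambda>(U, \<phi>). openin X U \<and> open (\<phi> ` U) \<and>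
    homeomorphic_map (subtopology X U) (top_of_set (\<phi> ` U)) \<phi>)"

definition compatible_charts :: "('p, 'n::finite) chart \<Rightarrow> ('p, 'n) chart \<Rightarrow> bool"
  where "compatible_charts = (\<lambda>(U, \<phi>) (V, \<psi>).
    holomorphic_vec_on (\<psi> \<circ> inv_into U \<phi>) (\<phi> ` (U \<inter> V)) \<and>
    holomorphic_vec_on (\<phi> \<circ> inv_into V \<psi>) (\<psi> ` (U \<inter> V)))"

definition complex_manifold :: "'p topology \<Rightarrow> ('p, 'n::finite) chart set \<Rightarrow> bool"
  where "complex_manifold X \<A> \<longleftrightarrow>
    Hausdorff_space X \<and> second_countable X \<and>
    (\<forall>c\<in>\<A>. is_chart X c) \<and> (\<Union>c\<in>\<A>. fst c) = topspace X \<and>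
    (\<forall>c\<in>\<A>. \<forall>d\<in>\<A>. compatible_charts c d)"

definition maximal_atlas :: "'p topology \<Rightarrow> ('p, 'n::finite) chart set \<Rightarrow> ('p, 'n) chart set"
  where "maximal_atlas X \<A> = {c. is_chart X c \<and> (\<forall>d\<in>\<A>. compatible_charts c d)}"

definition open_submanifold_atlas :: "('p, 'n::finite) chart set \<Rightarrow> 'p set \<Rightarrow> ('p, 'n) chart set"
  where "open_submanifold_atlas \<A> S = (\<lambda>(U, \<phi>). (U \<inter> S, \<phi>)) ` \<A>"

text \<open>The atlas of a complex surface \<open>S\<close> in a complex threefold: restrictions to \<open>S\<close> of the charts
  of the ambient manifold that flatten \<open>S\<close> to the plane in which the third coordinate vanishes.\<close>

definition slice_atlas :: "'p topology \<Rightarrow> ('p, 3) chart set \<Rightarrow> 'p set \<Rightarrow> ('p, 2) chart set"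
  where "slice_atlas X \<A> S =
    {(W \<inter> S, \<lambda>p. vector [\<phi> p $ 1, \<phi> p $ 2]) | W \<phi>.
      (W, \<phi>) \<in> maximal_atlas X \<A> \<and> \<phi> ` (W \<inter> S) = \<phi> ` W \<inter> {w. w $ 3 = 0}}"

definition holomorphic_mapping ::
    "'p topology \<Rightarrow> ('p, 'n::finite) chart set \<Rightarrow> 'q topology \<Rightarrow> ('q, 'm::finite) chart set \<Rightarrow>
      ('p \<Rightarrow> 'q) \<Rightarrow> bool"
  where "holomorphic_mapping X \<A> Y \<B> f \<longleftrightarrow> continuous_map X Y f \<and>
    (\<forall>(U, \<phi>)\<in>\<A>. \<forall>(V, \<psi>)\<in>\<B>.
      holomorphic_vec_on (\<psi> \<circ> f \<circ> inv_into U \<phi>) (\<phi> ` (U \<inter> f -` V)))"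

definition biholomorphic ::
    "'p topology \<Rightarrow> ('p, 'n::finite) chart set \<Rightarrow> 'q topology \<Rightarrow> ('q, 'm::finite) chart set \<Rightarrow> bool"
  where "biholomorphic X \<A> Y \<B> \<longleftrightarrow>
    (\<exists>f g. holomorphic_mapping X \<A> Y \<B> f \<and> holomorphic_mapping Y \<B> X \<A> g \<and>
      (\<forall>x\<in>topspace X. g (f x) = x) \<and> (\<forall>y\<in>topspace Y. f (g y) = y))"

text \<open>The holomorphic charts of an open set \<open>M\<close> with almost complex structure \<open>J\<close>: those
  diffeomorphisms \<open>\<phi>\<close> from open subsets of \<open>M\<close> to open subsets of complex affine space with
  \<open>d\<phi> \<circ> J = \<i> d\<phi>\<close> (so also \<open>d\<phi>\<inverse> \<circ> \<i> = J \<circ> d\<phi>\<inverse>\<close>). \<open>J\<close> is integrable iff their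
  domains cover \<open>M\<close>; since changes of coordinates are then holomorphic, hence smooth, it makes no
  difference that only differentiability is required of the charts.\<close>

definition almost_complex_atlas ::
    "'a::euclidean_space set \<Rightarrow> ('a \<Rightarrow> 'a \<Rightarrow> 'a) \<Rightarrow> ('a, 'n::finite) chart set"
  where "almost_complex_atlas M J = {(U, \<phi>). open U \<and> U \<subseteq> M \<and> inj_on \<phi> U \<and> open (\<phi> ` U) \<and>
    (\<forall>q\<in>U. \<exists>D. (\<phi> has_derivative D) (at q) \<and> (\<forall>v. D (J q v) = \<i> *s D v)) \<and>
    (\<forall>w\<in>\<phi> ` U. \<exists>E. (inv_into U \<phi> has_derivative E) (at w) \<and>
      (\<forall>v. E (\<i> *s v) = J (inv_into U \<phi> w) (E v)))}"


section \<open>Complex projective space\<close>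

definition homogeneous :: "complex^'n \<Rightarrow> (complex^'n) set"
  where "homogeneous Z = {c *s Z | c. c \<noteq> 0}"

definition projective_points :: "(complex^'n) set set"
  where "projective_points = homogeneous ` (UNIV - {0})"

text \<open>The quotient topology\<close>

definition projective_space :: "(complex^'n) set topology"
  where "projective_space =
    topology (\<lambda>S. S \<subseteq> projective_points \<and> open {Z. Z \<noteq> 0 \<and> homogeneous Z \<in> S})"

lemma openin_projective_space:
  fixes S :: "(complex^'n) set set"
  shows "openin projective_space S \<longleftrightarrow>
    S \<subseteq> projective_points \<and> open {Z. Z \<noteq> 0 \<and> homogeneous Z \<in> S}"
proof -
  have "istopology (\<lambda>S. S \<subseteq> projective_points \<and> open {Z::complex^'n. Z \<noteq> 0 \<and> homogeneous Z \<in> S})"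
    unfolding istopology_def
  proof (intro conjI allI impI)
    fix S T :: "(complex^'n) set set"
    assume *: "S \<subseteq> projective_points \<and> open {Z. Z \<noteq> 0 \<and> homogeneous Z \<in> S}"
      "T \<subseteq> projective_points \<and> open {Z. Z \<noteq> 0 \<and> homogeneous Z \<in> T}"
    have "{Z. Z \<noteq> 0 \<and> homogeneous Z \<in> S \<inter> T} =
        {Z. Z \<noteq> 0 \<and> homogeneous Z \<in> S} \<inter> {Z. Z \<noteq> 0 \<and> homogeneous Z \<in> T}"
      by blast
    with * show "open {Z. Z \<noteq> 0 \<and> homogeneous Z \<in> S \<inter> T}"
      by (simp add: open_Int)
    from * show "S \<inter> T \<subseteq> projective_points" by blast
  next
    fix \<K> :: "(complex^'n) set set set"
    assume *: "\<forall>K\<in>\<K>. K \<subseteq> projective_points \<and> open {Z. Z \<noteq> 0 \<and> homogeneous Z \<in> K}"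
    have "{Z. Z \<noteq> 0 \<and> homogeneous Z \<in> \<Union>\<K>} = (\<Union>K\<in>\<K>. {Z. Z \<noteq> 0 \<and> homogeneous Z \<in> K})"
      by blast
    with * show "open {Z. Z \<noteq> 0 \<and> homogeneous Z \<in> \<Union>\<K>}"
      by (simp add: open_UN)
    from * show "\<Union>\<K> \<subseteq> projective_points" by blast
  qed
  then show ?thesis
    by (simp add: projective_space_def topology_inverse')
qed

text \<open>Affine coordinates of \<open>\<complex>\<P>\<^sup>3\<close> where \<open>Z\<^sub>j \<noteq> 0\<close>, taken in the cyclic order
  \<open>j + 1, j + 2, j + 3\<close> of the remaining indices; the index type 4 is \<open>{0, 1, 2, 3}\<close> modulo 4.
  The ratios do not depend on the representative.\<close>

definition affine_chart :: "4 \<Rightarrow> ((complex^4) set, 3) chart"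
  where "affine_chart j =
    (homogeneous ` {Z. Z $ j \<noteq> 0},
     \<lambda>p. let Z = (SOME Z. Z \<in> p) in
       vector [Z $ (j + 1) / Z $ j, Z $ (j + 2) / Z $ j, Z $ (j + 3) / Z $ j])"

definition CP3_atlas :: "((complex^4) set, 3) chart set"
  where "CP3_atlas = range affine_chart"

definition quadric :: "(complex^4) set set"
  where "quadric = homogeneous ` {Z. Z \<noteq> 0 \<and> Z $ 0 * Z $ 3 = Z $ 1 * Z $ 2}"

definition upper_half_plane :: "complex set"
  where "upper_half_plane = {z. Im z > 0}"

definition quadric_plus :: "(complex^4) set set"
  where "quadric_plus = homogeneous ` {Z. Z \<noteq> 0 \<and> Z $ 0 * Z $ 3 = Z $ 1 * Z $ 2 \<and>
    (Z $ 0 \<noteq> 0 \<and> Z $ 2 / Z $ 0 \<in> upper_half_plane \<or>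
     Z $ 1 \<noteq> 0 \<and> Z $ 3 / Z $ 1 \<in> upper_half_plane)}"

definition quadric_plus_topology :: "(complex^4) set topology"
  where "quadric_plus_topology = subtopology projective_space quadric_plus"

definition quadric_atlas :: "((complex^4) set, 2) chart set"
  where "quadric_atlas = slice_atlas projective_space CP3_atlas quadric"

definition quadric_plus_atlas :: "((complex^4) set, 2) chart set"
  where "quadric_plus_atlas = open_submanifold_atlas quadric_atlas quadric_plus"


section \<open>Quaternions\<close>

text \<open>The quaternion \<open>a + bi + cj + dk\<close> has components \<open>a, b, c, d\<close> at the indices 0, 1, 2, 3. The
  Euclidean norm is the quaternionic one, but \<open>*\<close> is componentwise and must not be used.\<close>

type_synonym quaternion = "real^4"

definition quaternion_mult :: "quaternion \<Rightarrow> quaternion \<Rightarrow> quaternion"  (infixl "\<star>" 70)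
  where "p \<star> q = (\<chi> i.
    if i = 0 then p$0 * q$0 - p$1 * q$1 - p$2 * q$2 - p$3 * q$3
    else if i = 1 then p$0 * q$1 + p$1 * q$0 + p$2 * q$3 - p$3 * q$2
    else if i = 2 then p$0 * q$2 - p$1 * q$3 + p$2 * q$0 + p$3 * q$1
    else p$0 * q$3 + p$1 * q$2 - p$2 * q$1 + p$3 * q$0)"

definition real_quaternions :: "quaternion set"
  where "real_quaternions = range (axis 0)"

definition quaternion_Im :: "quaternion \<Rightarrow> quaternion"
  where "quaternion_Im q = q - axis 0 (q $ 0)"

definition imaginary_unit :: "quaternion \<Rightarrow> quaternion"
  where "imaginary_unit q = quaternion_Im q /\<^sub>R norm (quaternion_Im q)"

definition JJ :: "quaternion \<Rightarrow> quaternion \<Rightarrow> quaternion"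
  where "JJ q v = imaginary_unit q \<star> v"

definition nonreal_topology :: "quaternion topology"
  where "nonreal_topology = top_of_set (- real_quaternions)"

definition nonreal_atlas :: "(quaternion, 2) chart set"
  where "nonreal_atlas = almost_complex_atlas (- real_quaternions) JJ"

end

(* Write a nonreal quaternion as q = x + y I with y > 0 and I in the unit sphere S^2 of imaginary
   quaternions. Left multiplication by I is the standard complex structure on the plane spanned by 1
   and I and is v |-> I \<times> v on the tangent plane of the sphere at I, so (q |-> (I, x + iy)) identifies the
   nonreal quaternions with CP^1 times the upper half plane. With the stereographic coordinate u of I
   and v = x + iy, the biholomorphism is q |-> [1, u, v, uv], a Segre embedding; in the coordinate 1/u
   around the other pole it reads [1/u, 1, v/u, v]. The map is the identity in these coordinates and
   the coordinates of the affine parts Z0 \<noteq> 0 and Z1 \<noteq> 0 of the quadric, so only the compatibility of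
   all charts in the atlases has to be checked. *)
theory Submission
  imports Defs
begin

section \<open>Holomorphic maps and charts\<close>

text \<open>The atlases in the statement are as large as possible: all differentiable charts that
  intertwine \<open>JJ\<close> with multiplication by i, and the slices of all charts in the maximal
  atlas of CP^3. Transitions between two unknown charts must therefore be holomorphic without any
  formula at hand: for \<open>JJ\<close> because the composed derivatives commute with i, for the
  quadric by passing through an affine chart of CP^3 and then restricting to the plane w3 = 0.
  Orientation decides which stereographic coordinates are admissible. Let b, c, e be the
  coefficients of i, j, k in q and r the norm of its imaginary part. Left multiplication by k sends
  i to j, so (b + ic) / (r + e), the projection from the south pole -k, is holomorphic, whereas (b +
  ic) / (r - e), the projection from k, is antiholomorphic. The second chart uses (b - ic) / (r -
  e), which is 1/u; it arises from the first by conjugation by the quaternion i, a symmetry of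
  \<open>JJ\<close>.\<close>

lemma has_derivative_vec_componentwise:
  fixes f :: "'a::real_normed_vector \<Rightarrow> 'b::euclidean_space^'n"
  assumes "\<And>i. ((\<lambda>x. f x $ i) has_derivative (\<lambda>h. D h $ i)) (at a)"
  shows "(f has_derivative D) (at a)"
proof -
  have "((\<lambda>x. f x \<bullet> b) has_derivative (\<lambda>h. D h \<bullet> b)) (at a)" if "b \<in> Basis" for b
  proof -
    from that obtain i u where b: "b = axis i u"
      by (auto simp: Basis_vec_def)
    show ?thesis
      unfolding b inner_axis by (intro has_derivative_inner_left assms)
  qed
  then show ?thesis
    by (subst has_derivative_componentwise_within) auto
qed

lemma differentiable_vec_componentwise:
  fixes f :: "'a::real_normed_vector \<Rightarrow> 'b::euclidean_space^'n"
  assumes "\<And>i. (\<lambda>x. f x $ i) differentiable (at a)"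
  shows "f differentiable (at a)"
proof -
  obtain D where "\<And>i. ((\<lambda>x. f x $ i) has_derivative D i) (at a)"
    using assms unfolding differentiable_def by metis
  then have "(f has_derivative (\<lambda>h. \<chi> i. D i h)) (at a)"
    by (intro has_derivative_vec_componentwise) simp
  then show ?thesis
    by (auto simp: differentiable_def)
qed

section \<open>Complex differentiability of scalar functions, and holomorphic maps\<close>

text \<open>Pointwise scalar version of \<open>holomorphic_vec_on\<close>: the components of the
  explicit projective charts and sections are rational functions, so closure under the field
  operations settles them.\<close>

definition complex_differentiable_at :: "(complex^'n \<Rightarrow> complex) \<Rightarrow> complex^'n \<Rightarrow> bool"
  where "complex_differentiable_at f x \<longleftrightarrow>
    (\<exists>D. (f has_derivative D) (at x) \<and> (\<forall>c v. D (c *s v) = c * D v))"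

named_theorems holo_intros

lemma complex_differentiable_at_const [holo_intros]: "complex_differentiable_at (\<lambda>x. c) x"
  unfolding complex_differentiable_at_def by (rule exI[of _ "\<lambda>_. 0"]) auto

lemma complex_differentiable_at_nth [holo_intros]: "complex_differentiable_at (\<lambda>x. x $ i) x"
  unfolding complex_differentiable_at_def
  by (rule exI[of _ "\<lambda>x. x $ i"])
     (auto intro: bounded_linear_imp_has_derivative bounded_linear_vec_nth)

lemma complex_differentiable_at_add [holo_intros]:
  assumes "complex_differentiable_at f x" "complex_differentiable_at g x"
  shows "complex_differentiable_at (\<lambda>x. f x + g x) x"
proof -
  obtain D E where "(f has_derivative D) (at x)" "\<forall>c v. D (c *s v) = c * D v"
    "(g has_derivative E) (at x)" "\<forall>c v. E (c *s v) = c * E v"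
    using assms unfolding complex_differentiable_at_def by blast
  then show ?thesis
    unfolding complex_differentiable_at_def
    by (intro exI[of _ "\<lambda>h. D h + E h"] conjI has_derivative_add) (auto simp: algebra_simps)
qed

lemma complex_differentiable_at_mult [holo_intros]:
  assumes "complex_differentiable_at f x" "complex_differentiable_at g x"
  shows "complex_differentiable_at (\<lambda>x. f x * g x) x"
proof -
  obtain D E where "(f has_derivative D) (at x)" "\<forall>c v. D (c *s v) = c * D v"
    "(g has_derivative E) (at x)" "\<forall>c v. E (c *s v) = c * E v"
    using assms unfolding complex_differentiable_at_def by blast
  then show ?thesis
    unfolding complex_differentiable_at_def
    by (intro exI[of _ "\<lambda>h. f x * E h + D h * g x"] conjI has_derivative_mult)
       (auto simp: algebra_simps)
qed

lemma complex_differentiable_at_diff [holo_intros]: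
  assumes "complex_differentiable_at f x" "complex_differentiable_at g x"
  shows "complex_differentiable_at (\<lambda>x. f x - g x) x"
  using complex_differentiable_at_add[OF assms(1)
      complex_differentiable_at_mult[OF complex_differentiable_at_const[of "-1"] assms(2)]]
  by simp

lemma complex_differentiable_at_divide [holo_intros]:
  assumes "complex_differentiable_at f x" "complex_differentiable_at g x" "g x \<noteq> 0"
  shows "complex_differentiable_at (\<lambda>x. f x / g x) x"
proof -
  obtain E where "(g has_derivative E) (at x)" "\<forall>c v. E (c *s v) = c * E v"
    using assms unfolding complex_differentiable_at_def by blast
  then have "complex_differentiable_at (\<lambda>x. inverse (g x)) x"
    unfolding complex_differentiable_at_def using assms(3)
    by (intro exI[of _ "\<lambda>h. - (inverse (g x) * E h * inverse (g x))"] conjI Deriv.has_derivative_inverse)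
       (auto simp: algebra_simps)
  from complex_differentiable_at_mult[OF assms(1) this] show ?thesis
    by (simp add: divide_inverse)
qed

text \<open>The condition is independent of \<open>x\<close>: it serves for vectors whose entries
  are given by cases on the index.\<close>

lemma complex_differentiable_at_if [holo_intros]:
  assumes "b \<Longrightarrow> complex_differentiable_at f x" "\<not> b \<Longrightarrow> complex_differentiable_at g x"
  shows "complex_differentiable_at (\<lambda>x. if b then f x else g x) x"
  using assms by (cases b) simp_all

lemma holomorphic_vec_on_componentwise:
  fixes f :: "complex^'n::finite \<Rightarrow> complex^'m::finite"
  assumes "\<And>x i. x \<in> S \<Longrightarrow> complex_differentiable_at (\<lambda>x. f x $ i) x"
  shows "holomorphic_vec_on f S"
  unfolding holomorphic_vec_on_def
proof
  fix x assume "x \<in> S"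
  then obtain D where D: "\<And>i. ((\<lambda>x. f x $ i) has_derivative D i) (at x)"
    "\<And>i c v. D i (c *s v) = c * D i v"
    using assms unfolding complex_differentiable_at_def by metis
  show "\<exists>D. (f has_derivative D) (at x) \<and> (\<forall>c v. D (c *s v) = c *s D v)"
    by (rule exI[of _ "\<lambda>h. \<chi> i. D i h"])
       (auto intro!: has_derivative_vec_componentwise simp: D vec_eq_iff)
qed

lemma holomorphic_vec_on_compose:
  fixes f :: "complex^'n::finite \<Rightarrow> complex^'m::finite"
    and g :: "complex^'m \<Rightarrow> complex^'k::finite"
  assumes "holomorphic_vec_on f S" "holomorphic_vec_on g T" "f ` S \<subseteq> T"
  shows "holomorphic_vec_on (g \<circ> f) S"
  unfolding holomorphic_vec_on_def
proof
  fix x assume x: "x \<in> S"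
  then obtain D where D: "(f has_derivative D) (at x)" "\<forall>c v. D (c *s v) = c *s D v"
    using assms(1) unfolding holomorphic_vec_on_def by blast
  have "f x \<in> T" using assms(3) x by blast
  then obtain E where E: "(g has_derivative E) (at (f x))" "\<forall>c v. E (c *s v) = c *s E v"
    using assms(2) unfolding holomorphic_vec_on_def by blast
  show "\<exists>D. (g \<circ> f has_derivative D) (at x) \<and> (\<forall>c v. D (c *s v) = c *s D v)"
    using diff_chain_at[OF D(1) E(1)] D(2) E(2) by (intro exI[of _ "E \<circ> D"]) auto
qed

text \<open>Derivatives are taken in the full space, so agreement is required on an open set around
  \<open>S\<close>, not just on \<open>S\<close>.\<close>

lemma holomorphic_vec_on_cong:
  fixes f g :: "complex^'n::finite \<Rightarrow> complex^'m::finite"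
  assumes "holomorphic_vec_on g S" "S \<subseteq> N" "open N" "\<And>y. y \<in> N \<Longrightarrow> f y = g y"
  shows "holomorphic_vec_on f S"
  unfolding holomorphic_vec_on_def
proof
  fix x assume x: "x \<in> S"
  then obtain D where "(g has_derivative D) (at x)" "\<forall>c v. D (c *s v) = c *s D v"
    using assms(1) unfolding holomorphic_vec_on_def by blast
  moreover from this(1) have "(f has_derivative D) (at x)"
    by (rule has_derivative_transform_within_open[OF _ assms(3)]) (use x assms in auto)
  ultimately show "\<exists>D. (f has_derivative D) (at x) \<and> (\<forall>c v. D (c *s v) = c *s D v)"
    by blast
qed

text \<open>Allows a different factorisation near each point of \<open>S\<close>.\<close>

lemma holomorphic_vec_on_points:
  "holomorphic_vec_on f S \<longleftrightarrow> (\<forall>x\<in>S. holomorphic_vec_on f {x})"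
  by (auto simp: holomorphic_vec_on_def)

lemma holomorphic_vec_on_subset:
  "holomorphic_vec_on f T \<Longrightarrow> S \<subseteq> T \<Longrightarrow> holomorphic_vec_on f S"
  by (auto simp: holomorphic_vec_on_def)

lemma holomorphic_vec_on_imp_continuous_on:
  assumes "holomorphic_vec_on f S" shows "continuous_on S f"
  using assms unfolding holomorphic_vec_on_def
  by (blast intro: continuous_at_imp_continuous_on has_derivative_continuous)

section \<open>Charts and their transitions\<close>

text \<open>Since \<open>U\<close> is open, openness in the subtopology on \<open>U\<close> is
  openness in \<open>X\<close>; the same holds on the image side. This removes subtopologies from
  all later arguments about charts.\<close>

lemma is_chart_iff:
  "is_chart X (U, \<phi>) \<longleftrightarrow> openin X U \<and> inj_on \<phi> U \<and>
    (\<forall>N. openin X N \<longrightarrow> open (\<phi> ` (U \<inter> N))) \<and> (\<forall>N. open N \<longrightarrow> openin X (U \<inter> \<phi> -` N))"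
  (is "?L \<longleftrightarrow> ?R")
proof
  assume L: ?L
  then have U: "openin X U" "open (\<phi> ` U)"
    and h: "homeomorphic_map (subtopology X U) (top_of_set (\<phi> ` U)) \<phi>"
    by (auto simp: is_chart_def)
  have UX: "U \<subseteq> topspace X" using U(1) by (rule openin_subset)
  have inj: "inj_on \<phi> U"
    using homeomorphic_imp_injective_map[OF h] UX by (simp add: Int_absorb1)
  have c: "continuous_map (subtopology X U) (top_of_set (\<phi> ` U)) \<phi>"
    using h by (rule homeomorphic_imp_continuous_map)
  have o: "open_map (subtopology X U) (top_of_set (\<phi> ` U)) \<phi>"
    using h by (rule homeomorphic_imp_open_map)
  have "open (\<phi> ` (U \<inter> N))" if "openin X N" for N
  proof -
    have "openin (subtopology X U) (U \<inter> N)"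
      using that U(1) by (simp add: openin_Int openin_open_subtopology)
    then have "openin (top_of_set (\<phi> ` U)) (\<phi> ` (U \<inter> N))"
      using o by (auto simp: open_map_def)
    then show ?thesis using U(2) by (simp add: openin_open_eq)
  qed
  moreover have "openin X (U \<inter> \<phi> -` N)" if "open N" for N
  proof -
    have "openin (top_of_set (\<phi> ` U)) (\<phi> ` U \<inter> N)"
      using that by (simp add: openin_open_Int)
    then have "openin (subtopology X U) {x \<in> topspace (subtopology X U). \<phi> x \<in> \<phi> ` U \<inter> N}"
      using c by (auto simp: continuous_map_def)
    moreover have "{x \<in> topspace (subtopology X U). \<phi> x \<in> \<phi> ` U \<inter> N} = U \<inter> \<phi> -` N"
      using UX by auto
    ultimately show ?thesis
      using U(1) by (simp add: openin_open_subtopology)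
  qed
  ultimately show ?R using U inj by simp
next
  assume R: ?R
  then have U: "openin X U" and UX: "U \<subseteq> topspace X" by (auto dest: openin_subset)
  from R have op: "open (\<phi> ` U)"
    by (metis Int_absorb UX inf.absorb1 openin_topspace)
  have "homeomorphic_map (subtopology X U) (top_of_set (\<phi> ` U)) \<phi>"
  proof (rule bijective_open_imp_homeomorphic_map)
    show "continuous_map (subtopology X U) (top_of_set (\<phi> ` U)) \<phi>"
      unfolding continuous_map_def
    proof (intro conjI allI impI)
      show "\<phi> \<in> topspace (subtopology X U) \<rightarrow> topspace (top_of_set (\<phi> ` U))" by auto
    next
      fix T assume "openin (top_of_set (\<phi> ` U)) T"
      then have "open T" using op by (simp add: openin_open_eq)
      then have "openin X (U \<inter> \<phi> -` T)" using R by blast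
      moreover have "{x \<in> topspace (subtopology X U). \<phi> x \<in> T} = U \<inter> \<phi> -` T"
        using UX by auto
      ultimately show "openin (subtopology X U) {x \<in> topspace (subtopology X U). \<phi> x \<in> T}"
        using U by (simp add: openin_open_subtopology)
    qed
    show "open_map (subtopology X U) (top_of_set (\<phi> ` U)) \<phi>"
      unfolding open_map_def
    proof (intro allI impI)
      fix T assume "openin (subtopology X U) T"
      then have "openin X T" "T \<subseteq> U" using U by (auto simp: openin_open_subtopology)
      then have "open (\<phi> ` T)" using R by (metis Int_absorb1)
      then show "openin (top_of_set (\<phi> ` U)) (\<phi> ` T)"
        using op \<open>T \<subseteq> U\<close> by (auto simp: openin_open_eq)
    qed
    show "\<phi> ` topspace (subtopology X U) = topspace (top_of_set (\<phi> ` U))"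
      using UX by auto
    show "inj_on \<phi> (topspace (subtopology X U))"
      using R UX by (auto simp: Int_absorb1)
  qed
  then show ?L using U op by (simp add: is_chart_def)
qed

lemma compatible_charts_sym: "compatible_charts c d \<longleftrightarrow> compatible_charts d c"
  by (auto simp: compatible_charts_def Int_commute split: prod.splits)

lemma holomorphic_transition:
  assumes "compatible_charts (U, \<phi>) (V, \<psi>)"
  shows "holomorphic_vec_on (\<psi> \<circ> inv_into U \<phi>) (\<phi> ` (U \<inter> V))"
  using assms by (simp add: compatible_charts_def)

text \<open>Near a point, with a chart \<alpha> of the atlas around it, the transition factors
  through \<alpha> into two transitions that are holomorphic by assumption. The chart varies with
  the point, so this is done pointwise.\<close>

lemma holomorphic_transition_via_atlas:
  assumes cov: "topspace X \<subseteq> (\<Union>c\<in>\<A>. fst c)"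
    and \<A>: "\<And>c. c \<in> \<A> \<Longrightarrow> is_chart X c"
    and c: "is_chart X (U, \<phi>)" and d: "is_chart X (V, \<psi>)"
    and "\<And>a. a \<in> \<A> \<Longrightarrow> compatible_charts (U, \<phi>) a"
    and "\<And>a. a \<in> \<A> \<Longrightarrow> compatible_charts a (V, \<psi>)"
  shows "holomorphic_vec_on (\<psi> \<circ> inv_into U \<phi>) (\<phi> ` (U \<inter> V))"
proof (subst holomorphic_vec_on_points, safe)
  fix p assume p: "p \<in> U" "p \<in> V"
  have "p \<in> topspace X" using c p by (auto simp: is_chart_iff dest: openin_subset)
  with cov obtain A \<alpha> where a: "(A, \<alpha>) \<in> \<A>" "p \<in> A" by fastforce
  have injs: "inj_on \<phi> U" "inj_on \<alpha> A" and opens: "openin X V" "openin X A"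
    using c d \<A>[OF a(1)] by (auto simp: is_chart_iff)
  have "holomorphic_vec_on ((\<psi> \<circ> inv_into A \<alpha>) \<circ> (\<alpha> \<circ> inv_into U \<phi>)) (\<phi> ` (U \<inter> (V \<inter> A)))"
  proof (rule holomorphic_vec_on_compose)
    show "holomorphic_vec_on (\<alpha> \<circ> inv_into U \<phi>) (\<phi> ` (U \<inter> (V \<inter> A)))"
      by (rule holomorphic_vec_on_subset[OF holomorphic_transition[of U \<phi> A \<alpha>]])
         (use assms(5) a in auto)
    show "holomorphic_vec_on (\<psi> \<circ> inv_into A \<alpha>) (\<alpha> ` (A \<inter> V))"
      by (rule holomorphic_transition) (use assms(6) a in auto)
  qed (use injs in auto)
  moreover have "open (\<phi> ` (U \<inter> (V \<inter> A)))"
    using c opens by (auto simp: is_chart_iff)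
  ultimately have "holomorphic_vec_on (\<psi> \<circ> inv_into U \<phi>) (\<phi> ` (U \<inter> (V \<inter> A)))"
    by (rule holomorphic_vec_on_cong[OF _ subset_refl]) (use injs in auto)
  then show "holomorphic_vec_on (\<psi> \<circ> inv_into U \<phi>) {\<phi> p}"
    by (rule holomorphic_vec_on_subset) (use p a in auto)
qed

section \<open>Maps that are the identity in suitable charts\<close>

text \<open>On \<open>U\<close> the preimage of \<open>N\<close> contains, and near \<open>p\<close>
  is given by, the \<phi>-preimage of the open set \<psi>(V \<inter> N). Only the chart property is
  assumed, so the lemma applies before \<open>Y\<close> is known to be Hausdorff.\<close>

lemma continuous_map_matching_charts:
  fixes \<A> :: "('p, 'n::finite) chart set" and \<B> :: "('q, 'n) chart set"
  assumes \<A>: "\<And>c. c \<in> \<A> \<Longrightarrow> is_chart X c" and \<B>: "\<And>c. c \<in> \<B> \<Longrightarrow> is_chart Y c"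
    and match: "\<And>p. p \<in> topspace X \<Longrightarrow> \<exists>U \<phi> V \<psi>. (U, \<phi>) \<in> \<A> \<and> (V, \<psi>) \<in> \<B> \<and>
      p \<in> U \<and> f ` U \<subseteq> V \<and> (\<forall>x\<in>U. \<psi> (f x) = \<phi> x)"
  shows "continuous_map X Y f"
  unfolding continuous_map_def
proof (intro conjI allI impI)
  show "f \<in> topspace X \<rightarrow> topspace Y"
  proof
    fix p assume "p \<in> topspace X"
    from match[OF this] obtain V \<psi> where "(V, \<psi>) \<in> \<B>" "f p \<in> V" by blast
    then show "f p \<in> topspace Y"
      using \<B> by (fastforce simp: is_chart_iff dest: openin_subset)
  qed
next
  fix N assume N: "openin Y N"
  show "openin X {x \<in> topspace X. f x \<in> N}"
  proof (subst openin_subopen, safe)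
    fix p assume p: "p \<in> topspace X" "f p \<in> N"
    from match[OF p(1)] obtain U \<phi> V \<psi> where m: "(U, \<phi>) \<in> \<A>" "(V, \<psi>) \<in> \<B>"
      "p \<in> U" "f ` U \<subseteq> V" "\<forall>x\<in>U. \<psi> (f x) = \<phi> x" by blast
    have U: "openin X U" "\<And>N. open N \<Longrightarrow> openin X (U \<inter> \<phi> -` N)"
      using \<A>[OF m(1)] by (auto simp: is_chart_iff)
    have V: "inj_on \<psi> V" "open (\<psi> ` (V \<inter> N))"
      using \<B>[OF m(2)] N by (auto simp: is_chart_iff)
    have "openin X (U \<inter> \<phi> -` \<psi> ` (V \<inter> N))" using U V by blast
    moreover have "U \<inter> \<phi> -` \<psi> ` (V \<inter> N) \<subseteq> {x \<in> topspace X. f x \<in> N}"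
    proof safe
      fix x y assume x: "x \<in> U" "\<phi> x = \<psi> y" "y \<in> V" "y \<in> N"
      show "x \<in> topspace X" using x(1) U(1) openin_subset by blast
      have "f x \<in> V" "\<psi> (f x) = \<psi> y" using m x by auto
      then have "f x = y" using V(1) x by (auto dest: inj_onD)
      then show "f x \<in> N" using x by simp
    qed
    moreover have "\<phi> p = \<psi> (f p)" "f p \<in> V \<inter> N" using m p by auto
    then have "p \<in> U \<inter> \<phi> -` \<psi> ` (V \<inter> N)" using m(3) by blast
    ultimately show "\<exists>T. openin X T \<and> p \<in> T \<and> T \<subseteq> {x \<in> topspace X. f x \<in> N}" by blast
  qed
qed

text \<open>In the matched charts \<open>f\<close> is the identity, so in arbitrary charts it is a
  transition of the source atlas followed by a transition of the target atlas.\<close>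

lemma holomorphic_mapping_matching_charts:
  fixes \<A> :: "('p, 'n::finite) chart set" and \<B> :: "('q, 'n) chart set"
  assumes X: "complex_manifold X \<A>" and Y: "complex_manifold Y \<B>"
    and match: "\<And>p. p \<in> topspace X \<Longrightarrow> \<exists>U \<phi> V \<psi>. (U, \<phi>) \<in> \<A> \<and> (V, \<psi>) \<in> \<B> \<and>
      p \<in> U \<and> f ` U \<subseteq> V \<and> (\<forall>x\<in>U. \<psi> (f x) = \<phi> x)"
  shows "holomorphic_mapping X \<A> Y \<B> f"
proof -
  have \<A>: "\<And>c. c \<in> \<A> \<Longrightarrow> is_chart X c" and \<B>: "\<And>c. c \<in> \<B> \<Longrightarrow> is_chart Y c"
    and compat: "\<And>c d. c \<in> \<A> \<Longrightarrow> d \<in> \<A> \<Longrightarrow> compatible_charts c d"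
      "\<And>c d. c \<in> \<B> \<Longrightarrow> d \<in> \<B> \<Longrightarrow> compatible_charts c d"
    using X Y by (auto simp: complex_manifold_def)
  have cont: "continuous_map X Y f"
    by (rule continuous_map_matching_charts[OF \<A> \<B> match])
  have "holomorphic_vec_on (\<psi>' \<circ> f \<circ> inv_into U' \<phi>') (\<phi>' ` (U' \<inter> f -` V'))"
    if c': "(U', \<phi>') \<in> \<A>" and d': "(V', \<psi>') \<in> \<B>" for U' \<phi>' V' \<psi>'
  proof (subst holomorphic_vec_on_points, safe)
    fix p assume p: "p \<in> U'" "f p \<in> V'"
    have pX: "p \<in> topspace X" using \<A>[OF c'] p by (auto simp: is_chart_iff dest: openin_subset)
    from match[OF pX] obtain U \<phi> V \<psi> where m: "(U, \<phi>) \<in> \<A>" "(V, \<psi>) \<in> \<B>"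
      "p \<in> U" "f ` U \<subseteq> V" "\<forall>x\<in>U. \<psi> (f x) = \<phi> x" by blast
    \<comment> \<open>Open by continuity of \<open>f\<close>; it yields the open set on which the
      factorisation through the matched charts is valid.\<close>
    let ?N = "U \<inter> {x \<in> topspace X. f x \<in> V'}"
    have injs: "inj_on \<phi>' U'" "inj_on \<psi> V"
      using \<A>[OF c'] \<B>[OF m(2)] by (auto simp: is_chart_iff)
    have "openin X U" "openin Y V'" using \<A>[OF m(1)] \<B>[OF d'] by (auto simp: is_chart_iff)
    then have "openin X ?N"
      using cont by (intro openin_Int openin_continuous_map_preimage) auto
    then have op: "open (\<phi>' ` (U' \<inter> ?N))"
      using \<A>[OF c'] by (auto simp: is_chart_iff)
    have "holomorphic_vec_on ((\<psi>' \<circ> inv_into V \<psi>) \<circ> (\<phi> \<circ> inv_into U' \<phi>')) (\<phi>' ` (U' \<inter> ?N))"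
    proof (rule holomorphic_vec_on_compose)
      show "holomorphic_vec_on (\<phi> \<circ> inv_into U' \<phi>') (\<phi>' ` (U' \<inter> ?N))"
        by (rule holomorphic_vec_on_subset[OF holomorphic_transition]) (use compat c' m in auto)
      show "holomorphic_vec_on (\<psi>' \<circ> inv_into V \<psi>) (\<psi> ` (V \<inter> V'))"
        by (rule holomorphic_transition) (use compat d' m in auto)
      have "\<phi> x \<in> \<psi> ` (V \<inter> V')" if "x \<in> U" "f x \<in> V'" for x
        using m that by (metis IntI image_eqI image_subset_iff)
      then show "(\<phi> \<circ> inv_into U' \<phi>') ` \<phi>' ` (U' \<inter> ?N) \<subseteq> \<psi> ` (V \<inter> V')"
        using injs by auto
    qed
    then have "holomorphic_vec_on (\<psi>' \<circ> f \<circ> inv_into U' \<phi>') (\<phi>' ` (U' \<inter> ?N))"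
    proof (rule holomorphic_vec_on_cong[OF _ subset_refl op])
      fix y assume "y \<in> \<phi>' ` (U' \<inter> ?N)"
      then obtain x where x: "x \<in> U'" "x \<in> U" "y = \<phi>' x" by auto
      have "inv_into V \<psi> (\<phi> x) = f x"
        using m x injs(2) by (metis image_subset_iff inv_into_f_f)
      then show "(\<psi>' \<circ> f \<circ> inv_into U' \<phi>') y = ((\<psi>' \<circ> inv_into V \<psi>) \<circ> (\<phi> \<circ> inv_into U' \<phi>')) y"
        using x injs by simp
    qed
    then show "holomorphic_vec_on (\<psi>' \<circ> f \<circ> inv_into U' \<phi>') {\<phi>' p}"
      by (rule holomorphic_vec_on_subset) (use p m pX in auto)
  qed
  then show ?thesis
    using cont by (auto simp: holomorphic_mapping_def)
qed

section \<open>Charts of projective space and of surfaces\<close>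

lemma homogeneous_scale:
  assumes "c \<noteq> 0"
  shows "homogeneous (c *s Z) = homogeneous Z"
proof -
  have "\<exists>d'. d *s Z = d' *s (c *s Z) \<and> d' \<noteq> 0" if "d \<noteq> 0" for d
    using that assms by (intro exI[of _ "d / c"]) (simp add: vector_smult_assoc)
  moreover have "\<exists>d'. d *s (c *s Z) = d' *s Z \<and> d' \<noteq> 0" if "d \<noteq> 0" for d
    using that assms by (intro exI[of _ "d * c"]) (simp add: vector_smult_assoc)
  ultimately show ?thesis
    unfolding homogeneous_def by blast
qed

lemma homogeneous_eqD:
  assumes "homogeneous Z = homogeneous Z'"
  obtains c where "c \<noteq> 0" "Z = c *s Z'"
proof -
  have "Z \<in> homogeneous Z"
    unfolding homogeneous_def by (intro CollectI exI[of _ 1]) (simp add: vector_smult_lid)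
  with assms that show ?thesis
    by (auto simp: homogeneous_def)
qed

text \<open>For a set closed under scaling, membership does not depend on the representative, so
  conditions on points become conditions on vectors.\<close>

lemma homogeneous_in_image_iff:
  assumes "\<And>c Z. Z \<in> C \<Longrightarrow> c \<noteq> 0 \<Longrightarrow> c *s Z \<in> C"
  shows "homogeneous Z \<in> homogeneous ` C \<longleftrightarrow> Z \<in> C"
  using assms by (auto elim!: homogeneous_eqD)

lemma some_representative:
  assumes "\<And>c. c \<noteq> 0 \<Longrightarrow> F (c *s Z) = F Z"
  shows "F (SOME Z'. Z' \<in> homogeneous Z) = F Z"
proof -
  have "Z \<in> homogeneous Z"
    unfolding homogeneous_def by (intro CollectI exI[of _ 1]) (simp add: vector_smult_lid)
  then have "(SOME Z'. Z' \<in> homogeneous Z) \<in> homogeneous Z"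
    by (rule someI)
  with assms show ?thesis
    by (auto simp: homogeneous_def)
qed

lemma topspace_projective_space [simp]:
  "topspace projective_space = (projective_points :: (complex^'n) set set)"
proof -
  have "{Z :: complex^'n. Z \<noteq> 0 \<and> homogeneous Z \<in> projective_points} = - {0}"
    by (auto simp: projective_points_def)
  then have "openin projective_space (projective_points :: (complex^'n) set set)"
    by (simp add: openin_projective_space open_Compl)
  then show ?thesis
    by (meson openin_projective_space openin_subset openin_topspace subset_antisym)
qed

section \<open>Charts of projective space given by holomorphic sections\<close>

text \<open>A chart of projective space on the image of the open cone \<open>C\<close>: the coordinates of the
  point of \<open>Z\<close> are \<open>F Z\<close>, and \<open>s\<close> lifts the inverse of the chart to \<open>C\<close>.\<close>

definition section_chart ::
    "(complex^'m) set \<Rightarrow> (complex^'m \<Rightarrow> complex^'n) \<Rightarrow> (complex^'n \<Rightarrow> complex^'m) \<Rightarrow> bool"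
  where "section_chart C F s \<longleftrightarrow> open C \<and> 0 \<notin> C \<and>
    (\<forall>Z\<in>C. \<forall>c. c \<noteq> 0 \<longrightarrow> c *s Z \<in> C \<and> F (c *s Z) = F Z) \<and>
    (\<forall>w. s w \<in> C \<and> F (s w) = w) \<and>
    (\<forall>Z\<in>C. \<exists>c. c \<noteq> 0 \<and> Z = c *s s (F Z)) \<and>
    holomorphic_vec_on F C \<and> holomorphic_vec_on s UNIV"

definition chart_of_section ::
    "(complex^'m) set \<Rightarrow> (complex^'m \<Rightarrow> complex^'n) \<Rightarrow> ((complex^'m) set, 'n) chart"
  where "chart_of_section C F = (homogeneous ` C, \<lambda>p. F (SOME Z. Z \<in> p))"

lemma section_chart_coordinates:
  assumes "section_chart C F s" "Z \<in> C"
  shows "F (SOME Z'. Z' \<in> homogeneous Z) = F Z"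
  using assms by (intro some_representative) (auto simp: section_chart_def)

lemma section_chart_mem_iff:
  assumes "section_chart C F s"
  shows "homogeneous Z \<in> homogeneous ` C \<longleftrightarrow> Z \<in> C"
  using assms by (intro homogeneous_in_image_iff) (auto simp: section_chart_def)

lemma section_chart_section:
  assumes "section_chart C F s" "Z \<in> C"
  shows "homogeneous (s (F Z)) = homogeneous Z"
  using assms unfolding section_chart_def by (metis homogeneous_scale)

lemma section_chart_inj:
  assumes "section_chart C F s"
  shows "inj_on (\<lambda>p. F (SOME Z. Z \<in> p)) (homogeneous ` C)"
proof (rule inj_onI)
  fix p q assume pq: "p \<in> homogeneous ` C" "q \<in> homogeneous ` C"
    "F (SOME Y. Y \<in> p) = F (SOME Y. Y \<in> q)"
  then obtain Z Z' where Z: "Z \<in> C" "Z' \<in> C" "p = homogeneous Z" "q = homogeneous Z'" by auto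
  with pq have "F Z = F Z'" using section_chart_coordinates[OF assms] by simp
  then show "p = q"
    using section_chart_section[OF assms] Z by metis
qed

lemma is_chart_section_chart:
  fixes F :: "complex^'m::finite \<Rightarrow> complex^'n::finite"
  assumes S: "section_chart C F s"
  shows "is_chart projective_space (chart_of_section C F)"
  unfolding chart_of_section_def is_chart_iff
proof (intro conjI allI impI)
  have C: "open C" "0 \<notin> C" and s: "\<And>w. s w \<in> C" "\<And>w. F (s w) = w"
    and hol: "holomorphic_vec_on F C" "holomorphic_vec_on s UNIV"
    using S by (auto simp: section_chart_def)
  note coords = section_chart_coordinates[OF S] and mem = section_chart_mem_iff[OF S]
  have sub: "homogeneous ` C \<subseteq> projective_points"
    using C by (auto simp: projective_points_def)
  have "{Z. Z \<noteq> 0 \<and> homogeneous Z \<in> homogeneous ` C} = C"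
    using C(2) mem by auto
  then show "openin projective_space (homogeneous ` C)"
    using C sub by (simp add: openin_projective_space)
  show "inj_on (\<lambda>p. F (SOME Z. Z \<in> p)) (homogeneous ` C)"
    using S by (rule section_chart_inj)
  fix N :: "(complex^'m) set set" assume N: "openin projective_space N"
  have "(\<lambda>p. F (SOME Z. Z \<in> p)) ` (homogeneous ` C \<inter> N) = s -` {Z. Z \<noteq> 0 \<and> homogeneous Z \<in> N}"
  proof (intro subset_antisym subsetI)
    fix w assume "w \<in> (\<lambda>p. F (SOME Z. Z \<in> p)) ` (homogeneous ` C \<inter> N)"
    then obtain Z where Z: "Z \<in> C" "homogeneous Z \<in> N" "w = F Z"
      using coords by auto
    moreover have "s w \<noteq> 0" using s(1) C(2) by metis
    ultimately show "w \<in> s -` {Z. Z \<noteq> 0 \<and> homogeneous Z \<in> N}"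
      using section_chart_section[OF S] by simp
  next
    fix w assume "w \<in> s -` {Z. Z \<noteq> 0 \<and> homogeneous Z \<in> N}"
    then show "w \<in> (\<lambda>p. F (SOME Z. Z \<in> p)) ` (homogeneous ` C \<inter> N)"
      using s coords by (intro image_eqI[of _ _ "homogeneous (s w)"]) auto
  qed
  moreover have "open (s -` {Z. Z \<noteq> 0 \<and> homogeneous Z \<in> N})"
    using N holomorphic_vec_on_imp_continuous_on[OF hol(2)]
    by (intro open_vimage) (auto simp: openin_projective_space)
  ultimately show "open ((\<lambda>p. F (SOME Z. Z \<in> p)) ` (homogeneous ` C \<inter> N))" by simp
next
  have C: "open C" "0 \<notin> C" and hol: "holomorphic_vec_on F C"
    using S by (auto simp: section_chart_def)
  fix N :: "(complex^'n) set" assume N: "open N"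
  have "{Z. Z \<noteq> 0 \<and> homogeneous Z \<in> homogeneous ` C \<inter> (\<lambda>p. F (SOME Z. Z \<in> p)) -` N} = C \<inter> F -` N"
    using section_chart_coordinates[OF S] section_chart_mem_iff[OF S] C(2) by auto
  moreover have "open (C \<inter> F -` N)"
    using holomorphic_vec_on_imp_continuous_on[OF hol] C(1) N by (rule continuous_open_preimage)
  ultimately show "openin projective_space (homogeneous ` C \<inter> (\<lambda>p. F (SOME Z. Z \<in> p)) -` N)"
    using C(2) by (auto simp: openin_projective_space projective_points_def)
qed

lemma section_chart_inv_into:
  assumes S: "section_chart C F s"
  shows "inv_into (homogeneous ` C) (\<lambda>p. F (SOME Z. Z \<in> p)) w = homogeneous (s w)"
proof -
  have "s w \<in> C" "F (s w) = w" using S by (auto simp: section_chart_def)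
  then show ?thesis
    using section_chart_coordinates[OF S, of "s w"]
    by (intro inv_into_f_eq section_chart_inj[OF S]) auto
qed

lemma holomorphic_section_transition:
  fixes F :: "complex^'m::finite \<Rightarrow> complex^'n::finite" and F' :: "complex^'m \<Rightarrow> complex^'k::finite"
  assumes S: "section_chart C F s" and S': "section_chart C' F' s'"
  shows "holomorphic_vec_on ((\<lambda>p. F' (SOME Z. Z \<in> p)) \<circ> inv_into (homogeneous ` C) (\<lambda>p. F (SOME Z. Z \<in> p)))
     ((\<lambda>p. F (SOME Z. Z \<in> p)) ` (homogeneous ` C \<inter> homogeneous ` C'))"
    (is "holomorphic_vec_on ?t ?D")
proof -
  have C': "open C'" and hol: "holomorphic_vec_on s UNIV" "holomorphic_vec_on F' C'"
    using S S' by (auto simp: section_chart_def)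
  have 1: "holomorphic_vec_on (F' \<circ> s) (s -` C')"
    by (rule holomorphic_vec_on_compose[OF holomorphic_vec_on_subset[OF hol(1)] hol(2)]) auto
  have 2: "open (s -` C')"
    using C' holomorphic_vec_on_imp_continuous_on[OF hol(1)] by (intro open_vimage) auto
  have 3: "?D \<subseteq> s -` C'"
  proof
    fix w assume "w \<in> ?D"
    then obtain Z Z' where Z: "Z \<in> C" "Z' \<in> C'" "homogeneous Z = homogeneous Z'" "w = F Z"
      using section_chart_coordinates[OF S] by auto
    have "homogeneous (s (F Z)) = homogeneous Z'"
      using section_chart_section[OF S Z(1)] Z(3) by simp
    then show "w \<in> s -` C'"
      using section_chart_mem_iff[OF S'] Z by (metis imageI vimageI)
  qed
  have 4: "?t w = (F' \<circ> s) w" if "w \<in> s -` C'" for w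
    using that section_chart_inv_into[OF S] section_chart_coordinates[OF S'] by simp
  show ?thesis
    by (rule holomorphic_vec_on_cong[OF holomorphic_vec_on_subset[OF 1 3] 3 2 4])
qed

lemma compatible_section_charts:
  fixes F :: "complex^'m::finite \<Rightarrow> complex^'n::finite" and F' :: "complex^'m \<Rightarrow> complex^'n"
  assumes "section_chart C F s" "section_chart C' F' s'"
  shows "compatible_charts (chart_of_section C F) (chart_of_section C' F')"
  using holomorphic_section_transition[OF assms] holomorphic_section_transition[OF assms(2,1)]
  by (simp add: compatible_charts_def chart_of_section_def Int_commute)

section \<open>The affine charts of CP^3 and its maximal atlas\<close>

lemma open_nonzero_component: "open {Z :: complex^'n. Z $ i \<noteq> 0}"
  by (rule open_Collect_neq) (auto intro!: continuous_intros)

text \<open>Addition is modulo 4; this turns the cyclic order of coordinates in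
  \<open>affine_chart\<close> into a case distinction uniform in \<open>j\<close>.\<close>

lemma cyclic_cases_4: "i = j \<or> i = j + 1 \<or> i = j + 2 \<or> i = j + (3::4)"
  using exhaust_4[of i] exhaust_4[of j] by auto

lemma forall_cyclic_4: "(\<forall>i. P i) \<longleftrightarrow> P j \<and> P (j + 1) \<and> P (j + 2) \<and> P (j + (3::4))"
  using cyclic_cases_4[of _ j] by metis

lemma forall_0123: "(\<forall>i. P i) \<longleftrightarrow> P 0 \<and> P 1 \<and> P 2 \<and> P (3::4)"
  using forall_cyclic_4[of P 0] by simp

text \<open>The section is the representative with entry 1 at \<open>j\<close>; a vector
  \<open>Z\<close> is recovered from it with the factor \<open>Z $ j\<close>.\<close>

lemma section_chart_affine:
  "section_chart {Z :: complex^4. Z $ j \<noteq> 0}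
    (\<lambda>Z. vector [Z $ (j + 1) / Z $ j, Z $ (j + 2) / Z $ j, Z $ (j + 3) / Z $ j] :: complex^3)
    (\<lambda>w. \<chi> i. if i = j then 1 else if i = j + 1 then w $ 1 else if i = j + 2 then w $ 2 else w $ 3)"
  unfolding section_chart_def
proof (intro conjI ballI allI impI)
  show "holomorphic_vec_on
    (\<lambda>Z. vector [Z $ (j + 1) / Z $ j, Z $ (j + 2) / Z $ j, Z $ (j + 3) / Z $ j] :: complex^3)
    {Z :: complex^4. Z $ j \<noteq> 0}"
  proof (rule holomorphic_vec_on_componentwise)
    fix Z :: "complex^4" and i :: 3
    assume "Z \<in> {Z. Z $ j \<noteq> 0}"
    then show "complex_differentiable_at (\<lambda>Z. (vector [Z $ (j + 1) / Z $ j, Z $ (j + 2) / Z $ j,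
        Z $ (j + 3) / Z $ j] :: complex^3) $ i) Z"
      using exhaust_3[of i] by (auto intro!: holo_intros simp: vector_3)
  qed
  show "holomorphic_vec_on (\<lambda>w :: complex^3. \<chi> i. if i = j then 1 else if i = j + 1 then w $ 1
      else if i = j + 2 then w $ 2 else w $ 3) UNIV"
    by (rule holomorphic_vec_on_componentwise, simp only: vec_lambda_beta, intro holo_intros)
next
  fix Z :: "complex^4" assume "Z \<in> {Z. Z $ j \<noteq> 0}"
  then show "\<exists>c. c \<noteq> 0 \<and> Z = c *s (\<chi> i. if i = j then 1
     else if i = j + 1 then (vector [Z $ (j + 1) / Z $ j, Z $ (j + 2) / Z $ j, Z $ (j + 3) / Z $ j] :: complex^3) $ 1
     else if i = j + 2 then (vector [Z $ (j + 1) / Z $ j, Z $ (j + 2) / Z $ j, Z $ (j + 3) / Z $ j] :: complex^3) $ 2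
     else (vector [Z $ (j + 1) / Z $ j, Z $ (j + 2) / Z $ j, Z $ (j + 3) / Z $ j] :: complex^3) $ 3)"
    by (intro exI[of _ "Z $ j"]) (auto simp: vec_eq_iff forall_cyclic_4[where j = j] vector_3)
qed (auto simp: open_nonzero_component vec_eq_iff forall_3 vector_3)

lemma affine_chart_section: "\<exists>C F s. section_chart C F s \<and> affine_chart j = chart_of_section C F"
  unfolding affine_chart_def chart_of_section_def Let_def using section_chart_affine by blast

lemma CP3_atlas_sections: "c \<in> CP3_atlas \<Longrightarrow> \<exists>C F s. section_chart C F s \<and> c = chart_of_section C F"
  using affine_chart_section by (auto simp: CP3_atlas_def)

lemma CP3_atlas_is_chart: "c \<in> CP3_atlas \<Longrightarrow> is_chart projective_space c"
  using CP3_atlas_sections is_chart_section_chart by blast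

lemma CP3_atlas_cover: "topspace projective_space \<subseteq> (\<Union>c\<in>CP3_atlas. fst c)"
proof
  fix p assume "p \<in> topspace (projective_space :: (complex^4) set topology)"
  then obtain Z :: "complex^4" where Z: "Z \<noteq> 0" "p = homogeneous Z"
    by (auto simp: projective_points_def)
  then obtain j where "Z $ j \<noteq> 0" by (auto simp: vec_eq_iff)
  then have "p \<in> fst (affine_chart j)" using Z by (auto simp: affine_chart_def)
  then show "p \<in> (\<Union>c\<in>CP3_atlas. fst c)" by (auto simp: CP3_atlas_def)
qed

text \<open>The affine charts are section charts too, and any two of these are compatible. This
  admits charts other than the affine ones, in particular those adapted to the quadric.\<close>

lemma section_chart_in_maximal_atlas:
  assumes "section_chart C F s"
  shows "chart_of_section C F \<in> maximal_atlas projective_space CP3_atlas"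
  unfolding maximal_atlas_def
  using assms is_chart_section_chart compatible_section_charts CP3_atlas_sections by blast

lemma maximal_atlas_transition:
  assumes "topspace X \<subseteq> (\<Union>c\<in>\<A>. fst c)" "\<And>c. c \<in> \<A> \<Longrightarrow> is_chart X c"
    and "(U, \<phi>) \<in> maximal_atlas X \<A>" "(V, \<psi>) \<in> maximal_atlas X \<A>"
  shows "holomorphic_vec_on (\<psi> \<circ> inv_into U \<phi>) (\<phi> ` (U \<inter> V))"
  by (rule holomorphic_transition_via_atlas[OF assms(1,2)])
     (use assms(3,4) in \<open>auto simp: maximal_atlas_def intro: compatible_charts_sym[THEN iffD1]\<close>)

section \<open>Restricting flattening charts to a surface\<close>

definition flatten_plane :: "complex^2 \<Rightarrow> complex^3"
  where "flatten_plane w = vector [w $ 1, w $ 2, 0]"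

definition plane_part :: "complex^3 \<Rightarrow> complex^2"
  where "plane_part w = vector [w $ 1, w $ 2]"

lemma plane_part_flatten [simp]: "plane_part (flatten_plane w) = w"
  by (simp add: plane_part_def flatten_plane_def vec_eq_iff forall_2 vector_2 vector_3)

lemma flatten_plane_part: "w $ 3 = 0 \<Longrightarrow> flatten_plane (plane_part w) = w"
  by (simp add: plane_part_def flatten_plane_def vec_eq_iff forall_3 vector_2 vector_3)

lemma holomorphic_plane_part: "holomorphic_vec_on plane_part S"
proof (rule holomorphic_vec_on_componentwise)
  fix x i
  show "complex_differentiable_at (\<lambda>x. plane_part x $ i) x"
    using exhaust_2[of i] by (auto simp: plane_part_def vector_2 intro!: holo_intros)
qed

lemma holomorphic_flatten_plane: "holomorphic_vec_on flatten_plane S"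
proof (rule holomorphic_vec_on_componentwise)
  fix x i
  show "complex_differentiable_at (\<lambda>x. flatten_plane x $ i) x"
    using exhaust_3[of i] by (auto simp: flatten_plane_def vector_3 intro!: holo_intros)
qed

lemma slice_atlas_eq: "slice_atlas X \<A> S =
    {(W \<inter> S, plane_part \<circ> \<phi>) | W \<phi>. (W, \<phi>) \<in> maximal_atlas X \<A> \<and>
      \<phi> ` (W \<inter> S) = \<phi> ` W \<inter> {w. w $ 3 = 0}}"
  by (simp add: slice_atlas_def plane_part_def comp_def)

text \<open>By flatness, the image of an open part of the surface is the
  \<open>flatten_plane\<close>-preimage of the image of an open set of the threefold. The set
  \<open>T\<close> is built in so that the surface and its open subset are handled at once.\<close>

lemma is_chart_slice:
  assumes c: "is_chart X (W, \<phi>)" and flat: "\<phi> ` (W \<inter> S) = \<phi> ` W \<inter> {w. w $ 3 = 0}"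
    and T: "openin (subtopology X S) T"
  shows "is_chart (subtopology X T) (W \<inter> S \<inter> T, plane_part \<circ> \<phi>)"
proof -
  have inj: "inj_on \<phi> W" and W: "openin X W"
    and img: "\<And>N. openin X N \<Longrightarrow> open (\<phi> ` (W \<inter> N))"
    and pre: "\<And>N. open N \<Longrightarrow> openin X (W \<inter> \<phi> -` N)"
    using c by (auto simp: is_chart_iff)
  obtain O1 where O1: "openin X O1" "T = O1 \<inter> S" using T by (auto simp: openin_subtopology)
  have lift: "flatten_plane (plane_part (\<phi> p)) = \<phi> p" if "p \<in> W" "p \<in> S" for p
    using flat that by (intro flatten_plane_part) auto
  show ?thesis
    unfolding is_chart_iff
  proof (intro conjI allI impI)
    have "W \<inter> S \<inter> T = W \<inter> T" using O1 by auto
    then show "openin (subtopology X T) (W \<inter> S \<inter> T)"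
      using W by (auto simp: openin_subtopology)
    show "inj_on (plane_part \<circ> \<phi>) (W \<inter> S \<inter> T)"
      using inj lift by (intro inj_onI) (metis IntD1 IntD2 comp_apply inj_onD)
    fix N assume "openin (subtopology X T) N"
    then obtain O2 where O2: "openin X O2" "N = O2 \<inter> T" by (auto simp: openin_subtopology)
    have "(plane_part \<circ> \<phi>) ` (W \<inter> S \<inter> T \<inter> N) = flatten_plane -` \<phi> ` (W \<inter> (O1 \<inter> O2))"
    proof (intro subset_antisym subsetI)
      fix w assume "w \<in> (plane_part \<circ> \<phi>) ` (W \<inter> S \<inter> T \<inter> N)"
      then show "w \<in> flatten_plane -` \<phi> ` (W \<inter> (O1 \<inter> O2))"
        using lift O1 O2 by auto
    next
      fix w assume "w \<in> flatten_plane -` \<phi> ` (W \<inter> (O1 \<inter> O2))"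
      then obtain p where p: "flatten_plane w = \<phi> p" "p \<in> W" "p \<in> O1" "p \<in> O2" by blast
      \<comment> \<open>Flatness only provides some point of \<open>S\<close> with the value
        \<open>\<phi> p\<close>; injectivity of \<phi> then identifies it with
        \<open>p\<close>.\<close>
      have "\<phi> p $ 3 = 0" by (simp add: p(1)[symmetric] flatten_plane_def vector_3)
      with p(2) have "\<phi> p \<in> \<phi> ` (W \<inter> S)" by (simp add: flat)
      then have "p \<in> S" using inj p(2) by (auto dest: inj_onD)
      moreover have "w = (plane_part \<circ> \<phi>) p" by (simp add: p(1)[symmetric])
      ultimately show "w \<in> (plane_part \<circ> \<phi>) ` (W \<inter> S \<inter> T \<inter> N)"
        using p O1 O2 by blast
    qed
    moreover have "open (flatten_plane -` \<phi> ` (W \<inter> (O1 \<inter> O2)))"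
      using O1 O2 holomorphic_vec_on_imp_continuous_on[OF holomorphic_flatten_plane]
      by (intro open_vimage img openin_Int) auto
    ultimately show "open ((plane_part \<circ> \<phi>) ` (W \<inter> S \<inter> T \<inter> N))" by simp
  next
    fix N :: "(complex^2) set" assume "open N"
    then have "open (plane_part -` N)"
      using holomorphic_vec_on_imp_continuous_on[OF holomorphic_plane_part]
      by (intro open_vimage) auto
    then have "openin X (W \<inter> \<phi> -` plane_part -` N)" by (rule pre)
    moreover have "W \<inter> S \<inter> T \<inter> (plane_part \<circ> \<phi>) -` N = (W \<inter> \<phi> -` plane_part -` N) \<inter> T"
      using O1 by auto
    ultimately show "openin (subtopology X T) (W \<inter> S \<inter> T \<inter> (plane_part \<circ> \<phi>) -` N)"
      by (auto simp: openin_subtopology)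
  qed
qed

text \<open>The transition of slices is the ambient transition between the inclusion and the
  projection of the plane w3 = 0: \<open>flatten_plane\<close> undoes \<open>plane_part\<close> on
  the surface.\<close>

lemma slice_transition:
  assumes W: "is_chart X (W, \<phi>)" "\<phi> ` (W \<inter> S) = \<phi> ` W \<inter> {w. w $ 3 = 0}"
    and V: "is_chart X (V, \<psi>)" "\<psi> ` (V \<inter> S) = \<psi> ` V \<inter> {w. w $ 3 = 0}"
    and T: "openin (subtopology X S) T"
    and hol: "holomorphic_vec_on (\<psi> \<circ> inv_into W \<phi>) (\<phi> ` (W \<inter> V))"
  shows "holomorphic_vec_on ((plane_part \<circ> \<psi>) \<circ> inv_into (W \<inter> S \<inter> T) (plane_part \<circ> \<phi>))
    ((plane_part \<circ> \<phi>) ` ((W \<inter> S \<inter> T) \<inter> (V \<inter> S \<inter> T)))"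
    (is "holomorphic_vec_on ?t ?D")
proof -
  have lift: "flatten_plane (plane_part (\<phi> p)) = \<phi> p" if "p \<in> W" "p \<in> S" for p
    using W that by (intro flatten_plane_part) auto
  have inj: "inj_on \<phi> W" using W by (auto simp: is_chart_iff)
  have cW: "is_chart (subtopology X T) (W \<inter> S \<inter> T, plane_part \<circ> \<phi>)"
    and cV: "is_chart (subtopology X T) (V \<inter> S \<inter> T, plane_part \<circ> \<psi>)"
    using W V T by (auto intro: is_chart_slice)
  then have inj': "inj_on (plane_part \<circ> \<phi>) (W \<inter> S \<inter> T)" and op: "open ?D"
    unfolding is_chart_iff by blast+
  have "holomorphic_vec_on (plane_part \<circ> ((\<psi> \<circ> inv_into W \<phi>) \<circ> flatten_plane)) ?D"
    by (rule holomorphic_vec_on_compose[OF holomorphic_vec_on_compose[OF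
          holomorphic_flatten_plane hol] holomorphic_plane_part[of UNIV]])
       (use lift in auto)
  then show ?thesis
  proof (rule holomorphic_vec_on_cong[OF _ subset_refl op])
    fix w assume "w \<in> ?D"
    then obtain p where p: "p \<in> W \<inter> S \<inter> T" "w = (plane_part \<circ> \<phi>) p" by blast
    then show "?t w = (plane_part \<circ> ((\<psi> \<circ> inv_into W \<phi>) \<circ> flatten_plane)) w"
      using inv_into_f_f[OF inj' p(1)] inv_into_f_f[OF inj, of p] lift by simp
  qed
qed

section \<open>Almost complex structures\<close>

text \<open>The derivative \<open>E\<close> of the inverse of one chart turns i into
  \<open>J\<close>, and the derivative \<open>D\<close> of the other turns \<open>J\<close> back
  into i. So the real-linear map \<open>D \<circ> E\<close> commutes with i, hence with every
  complex scalar.\<close>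

lemma almost_complex_transition:
  assumes c: "(U, \<phi>) \<in> almost_complex_atlas M J" and d: "(V, \<psi>) \<in> almost_complex_atlas M J"
  shows "holomorphic_vec_on (\<psi> \<circ> inv_into U \<phi>) (\<phi> ` (U \<inter> V))"
  unfolding holomorphic_vec_on_def
proof safe
  fix p assume p: "p \<in> U" "p \<in> V"
  have inv: "inv_into U \<phi> (\<phi> p) = p"
    using c p by (auto simp: almost_complex_atlas_def)
  obtain D where D: "(\<psi> has_derivative D) (at p)" "\<forall>v. D (J p v) = \<i> *s D v"
    using d p by (auto simp: almost_complex_atlas_def)
  have "\<forall>w\<in>\<phi> ` U. \<exists>E. (inv_into U \<phi> has_derivative E) (at w) \<and>
      (\<forall>v. E (\<i> *s v) = J (inv_into U \<phi> w) (E v))"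
    using c unfolding almost_complex_atlas_def by blast
  from bspec[OF this imageI[OF p(1)]]
  obtain E where E: "(inv_into U \<phi> has_derivative E) (at (\<phi> p))" "\<forall>v. E (\<i> *s v) = J p (E v)"
    unfolding inv by blast
  have T: "(\<psi> \<circ> inv_into U \<phi> has_derivative D \<circ> E) (at (\<phi> p))"
    by (rule diff_chain_at[OF E(1)]) (simp add: inv D(1))
  then interpret DE: bounded_linear "D \<circ> E" by (rule has_derivative_bounded_linear)
  have "(D \<circ> E) (c *s v) = c *s (D \<circ> E) v" for c v
  proof -
    have split: "c *s w = Re c *\<^sub>R w + Im c *\<^sub>R (\<i> *s w)" for w :: "complex^'k"
      by (simp add: vec_eq_iff complex_eq_iff)
    have "(D \<circ> E) (c *s v) = Re c *\<^sub>R (D \<circ> E) v + Im c *\<^sub>R (D \<circ> E) (\<i> *s v)"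
      by (subst split) (simp only: DE.add DE.scaleR)
    also have "(D \<circ> E) (\<i> *s v) = \<i> *s (D \<circ> E) v" using D(2) E(2) by simp
    finally show ?thesis by (simp only: split[symmetric])
  qed
  with T show "\<exists>D. (\<psi> \<circ> inv_into U \<phi> has_derivative D) (at (\<phi> p)) \<and> (\<forall>c v. D (c *s v) = c *s D v)"
    by blast
qed

lemma almost_complex_is_chart:
  assumes "(U, \<phi>) \<in> almost_complex_atlas M J"
  shows "is_chart (top_of_set M) (U, \<phi>)"
proof -
  have U: "open U" "U \<subseteq> M" "inj_on \<phi> U" "open (\<phi> ` U)"
    and D: "\<forall>q\<in>U. \<exists>D. (\<phi> has_derivative D) (at q)"
      "\<forall>w\<in>\<phi> ` U. \<exists>E. (inv_into U \<phi> has_derivative E) (at w)"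
    using assms unfolding almost_complex_atlas_def by blast+
  from D(1) have c1: "continuous_on U \<phi>"
    by (blast intro: continuous_at_imp_continuous_on has_derivative_continuous)
  from D(2) have c2: "continuous_on (\<phi> ` U) (inv_into U \<phi>)"
    by (blast intro: continuous_at_imp_continuous_on has_derivative_continuous)
  show ?thesis
    unfolding is_chart_iff
  proof (intro conjI allI impI)
    show "openin (top_of_set M) U" using U by (simp add: open_subset)
    fix N assume "openin (top_of_set M) N"
    then obtain T where T: "open T" "N = M \<inter> T" by (auto simp: openin_open)
    have "\<phi> ` (U \<inter> N) = \<phi> ` U \<inter> inv_into U \<phi> -` T"
      using T U by auto
    then show "open (\<phi> ` (U \<inter> N))"
      using continuous_open_preimage[OF c2 U(4) T(1)] by simp
  next
    fix N :: "(complex^'b) set" assume "open N"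
    then have "open (U \<inter> \<phi> -` N)" using c1 U by (intro continuous_open_preimage)
    then show "openin (top_of_set M) (U \<inter> \<phi> -` N)" using U by (intro open_subset) auto
  qed (fact U)
qed

text \<open>The covering hypothesis is the integrability of \<open>J\<close>; compatibility comes
  from the equations for the charts, and the topological properties from the Euclidean
  space.\<close>

lemma almost_complex_manifold:
  assumes "M \<subseteq> (\<Union>c\<in>(almost_complex_atlas M J :: ('a::euclidean_space, 'n::finite) chart set). fst c)"
  shows "complex_manifold (top_of_set M) (almost_complex_atlas M J :: ('a, 'n) chart set)"
  unfolding complex_manifold_def
proof (intro conjI ballI)
  show "Hausdorff_space (top_of_set M)"
    by (simp add: Hausdorff_space_subtopology)
  have "second_countable (euclidean :: 'a topology)"
  proof -
    obtain \<B> :: "'a set set" where "countable \<B>" "\<And>C. C \<in> \<B> \<Longrightarrow> open C"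
      "\<And>S. open S \<Longrightarrow> \<exists>U. U \<subseteq> \<B> \<and> S = \<Union>U"
      by (rule univ_second_countable) blast
    then show ?thesis
      unfolding second_countable_def by (intro exI[of _ \<B>]) (simp; blast)
  qed
  then show "second_countable (top_of_set M)" by (rule second_countable_subtopology)
  show "(\<Union>c\<in>(almost_complex_atlas M J :: ('a, 'n) chart set). fst c) = topspace (top_of_set M)"
    using assms by (auto simp: almost_complex_atlas_def)
  fix c assume c: "c \<in> (almost_complex_atlas M J :: ('a, 'n) chart set)"
  then show "is_chart (top_of_set M) c"
    by (cases c) (simp add: almost_complex_is_chart)
  fix d assume d: "d \<in> (almost_complex_atlas M J :: ('a, 'n) chart set)"
  obtain U \<phi> V \<psi> where "c = (U, \<phi>)" "d = (V, \<psi>)" by fastforce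
  then show "compatible_charts c d"
    using c d almost_complex_transition[of U \<phi> M J V \<psi>] almost_complex_transition[of V \<psi> M J U \<phi>]
    by (simp add: compatible_charts_def Int_commute)
qed

text \<open>It suffices to check the Cauchy-Riemann equations for the inverse of the chart.\<close>

lemma almost_complex_atlasI:
  fixes \<phi> :: "'a::euclidean_space \<Rightarrow> complex^'n::finite"
  assumes U: "open U" "U \<subseteq> M" and V: "open V"
    and \<phi>: "\<And>q. q \<in> U \<Longrightarrow> \<phi> q \<in> V" "\<And>q. q \<in> U \<Longrightarrow> \<theta> (\<phi> q) = q"
    and \<theta>: "\<And>w. w \<in> V \<Longrightarrow> \<theta> w \<in> U" "\<And>w. w \<in> V \<Longrightarrow> \<phi> (\<theta> w) = w"
    and diff: "\<And>q. q \<in> U \<Longrightarrow> \<phi> differentiable (at q)"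
    and hol: "\<And>w. w \<in> V \<Longrightarrow> \<exists>E. (\<theta> has_derivative E) (at w) \<and> (\<forall>v. E (\<i> *s v) = J (\<theta> w) (E v))"
  shows "(U, \<phi>) \<in> almost_complex_atlas M J"
proof -
  have inj: "inj_on \<phi> U" using \<phi>(2) by (metis inj_onI)
  have img: "\<phi> ` U = V" using \<phi>(1) \<theta> by force
  have inv: "inv_into U \<phi> w = \<theta> w" if "w \<in> V" for w
    using \<theta>[OF that] inj by (metis inv_into_f_eq)
  have "\<exists>D. (\<phi> has_derivative D) (at q) \<and> (\<forall>v. D (J q v) = \<i> *s D v)" if q: "q \<in> U" for q
  proof -
    obtain D where D: "(\<phi> has_derivative D) (at q)"
      using diff[OF q] by (auto simp: differentiable_def)
    obtain E where E: "(\<theta> has_derivative E) (at (\<phi> q))" "\<forall>v. E (\<i> *s v) = J (\<theta> (\<phi> q)) (E v)"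
      using hol[OF \<phi>(1)[OF q]] by blast
    have "(\<phi> \<circ> \<theta> has_derivative D \<circ> E) (at (\<phi> q))"
      by (rule diff_chain_at[OF E(1)]) (simp add: \<phi>(2)[OF q] D)
    then have "((\<lambda>w. w) has_derivative D \<circ> E) (at (\<phi> q))"
      by (rule has_derivative_transform_within_open[OF _ V \<phi>(1)[OF q]]) (simp add: \<theta>)
    then have DE: "D (E w) = w" for w
      using has_derivative_unique[OF _ has_derivative_ident] by (metis comp_apply)
    have "(\<theta> \<circ> \<phi> has_derivative E \<circ> D) (at q)"
      by (rule diff_chain_at[OF D E(1)])
    then have "((\<lambda>p. p) has_derivative E \<circ> D) (at q)"
      by (rule has_derivative_transform_within_open[OF _ U(1) q]) (simp add: \<phi>)
    then have ED: "E (D v) = v" for v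
      using has_derivative_unique[OF _ has_derivative_ident] by (metis comp_apply)
    \<comment> \<open>\<open>D\<close> and \<open>E\<close> are mutually inverse: J v = J (E (D v))
      = E (i D v), and applying \<open>D\<close> leaves i D v.\<close>
    have "D (J q v) = \<i> *s D v" for v
      using E(2) \<phi>(2)[OF q] by (metis DE ED)
    with D show ?thesis by blast
  qed
  moreover have "\<exists>E. (inv_into U \<phi> has_derivative E) (at w) \<and>
      (\<forall>v. E (\<i> *s v) = J (inv_into U \<phi> w) (E v))" if w: "w \<in> V" for w
  proof -
    obtain E where E: "(\<theta> has_derivative E) (at w)" "\<forall>v. E (\<i> *s v) = J (\<theta> w) (E v)"
      using hol[OF w] by blast
    from E(1) have "(inv_into U \<phi> has_derivative E) (at w)"
      by (rule has_derivative_transform_within_open[OF _ V w]) (simp add: inv)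
    with E(2) show ?thesis by (auto simp: inv[OF w])
  qed
  ultimately show ?thesis
    unfolding almost_complex_atlas_def mem_Collect_eq prod.case img using U V inj by blast
qed

section \<open>Stereographic coordinates of quaternions\<close>

text \<open>\<open>vector\<close> would put its entries at 1, 2, 3 and 4 = 0; here they are at 0, 1,
  2, 3, as in the labelling of quaternions and homogeneous coordinates.\<close>

definition vec4 :: "'a \<Rightarrow> 'a \<Rightarrow> 'a \<Rightarrow> 'a \<Rightarrow> 'a^4"
  where "vec4 a b c d = (\<chi> i. if i = 0 then a else if i = 1 then b else if i = 2 then c else d)"

lemma vec4_nth [simp]:
  "vec4 a b c d $ 0 = a" "vec4 a b c d $ 1 = b" "vec4 a b c d $ 2 = c" "vec4 a b c d $ 3 = d"
  by (simp_all add: vec4_def)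

lemma quaternion_Im_nth [simp]:
  "quaternion_Im q $ 0 = 0" "quaternion_Im q $ 1 = q $ 1" "quaternion_Im q $ 2 = q $ 2"
  "quaternion_Im q $ 3 = q $ 3"
  by (simp_all add: quaternion_Im_def axis_def)

lemma bounded_linear_quaternion_Im: "bounded_linear quaternion_Im"
  unfolding linear_conv_bounded_linear[symmetric]
  by (rule linearI) (simp_all add: vec_eq_iff forall_0123)

lemma norm_quaternion_Im: "norm (quaternion_Im q) = sqrt ((q $ 1)\<^sup>2 + (q $ 2)\<^sup>2 + (q $ 3)\<^sup>2)"
proof -
  \<comment> \<open>\<open>sum_4\<close> runs over the indices 1 to 4, and its last index is the
    real part 0 in disguise.\<close>
  have "(4::4) = 0" by simp
  then have "quaternion_Im q $ 4 = 0" by (simp only: quaternion_Im_nth)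
  then show ?thesis by (simp add: norm_vec_def L2_set_def sum_4)
qed

lemma norm_quaternion_Im_square:
  "(norm (quaternion_Im q))\<^sup>2 = (q $ 1)\<^sup>2 + (q $ 2)\<^sup>2 + (q $ 3)\<^sup>2"
  by (simp add: norm_quaternion_Im)

lemma real_quaternions_iff: "q \<in> real_quaternions \<longleftrightarrow> norm (quaternion_Im q) = 0"
  by (auto simp: real_quaternions_def vec_eq_iff forall_0123 axis_def image_iff)

section \<open>The first chart and its inverse\<close>

text \<open>Off the set where \<open>I\<^sub>q\<close> is the south pole, a quaternion \<open>q = x + y I\<^sub>q\<close> has as coordinates
  the stereographic projection of \<open>I\<^sub>q\<close> and \<open>x + \<i> y\<close>.\<close>

definition north_domain :: "quaternion set"
  where "north_domain = {q. norm (quaternion_Im q) + q $ 3 > 0}"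

definition north_coords :: "quaternion \<Rightarrow> complex^2"
  where "north_coords q = vector
    [Complex (q $ 1) (q $ 2) / of_real (norm (quaternion_Im q) + q $ 3),
     Complex (q $ 0) (norm (quaternion_Im q))]"

text \<open>With u = x + iy, inverse stereographic projection is I = (2x, 2y, 1 - |u|^2) / (1 +
  |u|^2). Writing P = 1 / (1 + |u|^2), the last entry is 2P - 1, so P is the only non-polynomial
  term.\<close>

definition north_inverse :: "complex^2 \<Rightarrow> quaternion"
  where "north_inverse w =
    (let x = Re (w $ 1); y = Im (w $ 1); r = Im (w $ 2); P = inverse (1 + x * x + y * y)
     in vec4 (Re (w $ 2)) (r * (2 * x * P)) (r * (2 * y * P)) (r * (2 * P - 1)))"

text \<open>The common image of both quaternionic charts and both charts of the quadric.\<close>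

definition coords_range :: "(complex^2) set"
  where "coords_range = {w. w $ 2 \<in> upper_half_plane}"

lemma open_coords_range: "open coords_range"
  unfolding coords_range_def upper_half_plane_def
  by (auto intro!: open_Collect_less continuous_intros)

lemma open_north_domain: "open north_domain"
  unfolding north_domain_def
  by (auto intro!: open_Collect_less continuous_intros
      bounded_linear.continuous_on[OF bounded_linear_quaternion_Im])

lemma north_domain_nonreal: "north_domain \<subseteq> - real_quaternions"
proof
  fix q assume "q \<in> north_domain"
  moreover have "\<bar>q $ 3\<bar> \<le> norm (quaternion_Im q)"
    using component_le_norm_cart[of "quaternion_Im q" 3] by simp
  ultimately show "q \<in> - real_quaternions"
    by (auto simp: north_domain_def real_quaternions_iff)
qed

lemma one_plus_squares_pos: "(0::real) < 1 + x * x + y * y"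
  by (simp add: add_pos_nonneg)

lemma norm_north_inverse:
  assumes "w \<in> coords_range"
  shows "norm (quaternion_Im (north_inverse w)) = Im (w $ 2)"
proof -
  define x y r P where d: "x = Re (w $ 1)" "y = Im (w $ 1)" "r = Im (w $ 2)" 
    "P = inverse (1 + x * x + y * y)"
  have P: "P * (1 + x * x + y * y) = 1"
    using one_plus_squares_pos[of x y] by (simp add: d)
  \<comment> \<open>The three entries form a unit vector: the defining relation of P turns the
    right-hand side into 4P - 4P + 1.\<close>
  have "(2 * x * P)\<^sup>2 + (2 * y * P)\<^sup>2 + (2 * P - 1)\<^sup>2
      = 4 * P * (P * (1 + x * x + y * y)) - 4 * P + 1"
    by (simp add: power2_eq_square algebra_simps)
  then have "(2 * x * P)\<^sup>2 + (2 * y * P)\<^sup>2 + (2 * P - 1)\<^sup>2 = 1"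
    by (simp add: P)
  then have "(r * (2 * x * P))\<^sup>2 + (r * (2 * y * P))\<^sup>2 + (r * (2 * P - 1))\<^sup>2 = r\<^sup>2"
    by (simp only: power_mult_distrib[of r] distrib_left[symmetric] mult_1_right)
  moreover have "r > 0" using assms by (simp add: coords_range_def upper_half_plane_def d)
  ultimately show ?thesis
    by (simp add: norm_quaternion_Im north_inverse_def Let_def d)
qed

lemma imaginary_unit_north_inverse:
  assumes "w \<in> coords_range"
  shows "imaginary_unit (north_inverse w) =
    (let x = Re (w $ 1); y = Im (w $ 1); P = inverse (1 + x * x + y * y)
     in vec4 0 (2 * x * P) (2 * y * P) (2 * P - 1))"
proof -
  have "Im (w $ 2) \<noteq> 0" using assms by (auto simp: coords_range_def upper_half_plane_def)
  then show ?thesis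
    unfolding imaginary_unit_def norm_north_inverse[OF assms]
    by (simp add: vec_eq_iff forall_0123 north_inverse_def Let_def)
qed

lemma north_coords_inverse:
  assumes w: "w \<in> coords_range"
  shows "north_inverse w \<in> north_domain" "north_coords (north_inverse w) = w"
proof -
  define x y r P where d: "x = Re (w $ 1)" "y = Im (w $ 1)" "r = Im (w $ 2)" 
    "P = inverse (1 + x * x + y * y)"
  have P: "P > 0" using one_plus_squares_pos[of x y] by (simp add: d)
  have r: "r > 0" using w by (simp add: coords_range_def upper_half_plane_def d)
  have n: "north_inverse w = vec4 (Re (w $ 2)) (r * (2 * x * P)) (r * (2 * y * P)) (r * (2 * P - 1))"
    by (simp add: north_inverse_def Let_def d)
  \<comment> \<open>The denominator in \<open>north_coords\<close> is r + r (2P - 1); it cancels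
    against the numerators 2rxP and 2ryP.\<close>
  have s: "norm (quaternion_Im (north_inverse w)) + north_inverse w $ 3 = 2 * r * P"
    unfolding norm_north_inverse[OF w] by (simp add: n d(3)[symmetric] algebra_simps)
  then show "north_inverse w \<in> north_domain" using P r by (simp add: north_domain_def)
  show "north_coords (north_inverse w) = w"
    unfolding north_coords_def unfolding s unfolding norm_north_inverse[OF w]
    using P r by (simp add: n vec_eq_iff forall_2 vector_2 complex_eq_iff d(1-3))
qed

lemma north_inverse_coords:
  assumes "q \<in> north_domain"
  shows "north_coords q \<in> coords_range" "north_inverse (north_coords q) = q"
proof -
  define r b c e where d: "r = norm (quaternion_Im q)" "b = q $ 1" "c = q $ 2" "e = q $ 3"
  have rc: "r + e > 0" using assms by (simp add: north_domain_def d)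
  have sq: "r\<^sup>2 = b\<^sup>2 + c\<^sup>2 + e\<^sup>2" by (simp add: d norm_quaternion_Im_square)
  have r: "r > 0"
    using assms north_domain_nonreal real_quaternions_iff[of q] by (auto simp: d less_le)
  show "north_coords q \<in> coords_range"
    using r by (simp add: coords_range_def upper_half_plane_def north_coords_def vector_2 d)
  have "1 + b / (r + e) * (b / (r + e)) + c / (r + e) * (c / (r + e))
      = ((r + e)\<^sup>2 + (b\<^sup>2 + c\<^sup>2)) / (r + e)\<^sup>2"
    using rc by (simp add: add_divide_distrib power2_eq_square)
  \<comment> \<open>By the sphere equation b^2 + c^2 = (r + e) (r - e), so r + e factors out and P
    becomes (r + e) / (2r).\<close>
  also have "(r + e)\<^sup>2 + (b\<^sup>2 + c\<^sup>2) = 2 * r * (r + e)"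
    using sq by (simp add: power2_eq_square algebra_simps)
  finally have P: "inverse (1 + b / (r + e) * (b / (r + e)) + c / (r + e) * (c / (r + e)))
      = (r + e) / (2 * r)"
    using rc r by (simp add: power2_eq_square)
  have "north_coords q $ 1 = Complex (b / (r + e)) (c / (r + e))"
    "north_coords q $ 2 = Complex (q $ 0) r"
    using rc by (simp_all add: north_coords_def vector_2 d complex_eq_iff)
  then have "north_inverse (north_coords q) =
      vec4 (q $ 0) (r * (2 * (b / (r + e)) * ((r + e) / (2 * r))))
        (r * (2 * (c / (r + e)) * ((r + e) / (2 * r)))) (r * (2 * ((r + e) / (2 * r)) - 1))"
    unfolding north_inverse_def Let_def by (simp only: complex.sel P)
  also have "\<dots> = q"
  proof -
    have "r * (2 * (t / (r + e)) * ((r + e) / (2 * r))) = t" for t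
      using r rc by simp
    moreover have "r * (2 * ((r + e) / (2 * r)) - 1) = e"
      using r by (simp add: right_diff_distrib add_divide_distrib)
    ultimately show ?thesis by (simp add: vec_eq_iff forall_0123 d(2-4)[symmetric])
  qed
  finally show "north_inverse (north_coords q) = q" .
qed

text \<open>The norm is differentiable away from 0, and the imaginary part is nonzero on this
  domain. Real differentiability suffices, since the Cauchy-Riemann equations are checked on the
  inverse.\<close>

lemma differentiable_north_coords:
  assumes "q \<in> north_domain"
  shows "north_coords differentiable (at q)"
proof (rule differentiable_vec_componentwise)
  have "quaternion_Im q \<noteq> 0"
    using assms north_domain_nonreal real_quaternions_iff[of q] by auto
  then have n: "(\<lambda>q. norm (quaternion_Im q)) differentiable (at q)"
    using differentiable_chain_at[of quaternion_Im q norm]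
    by (simp add: comp_def bounded_linear_imp_differentiable bounded_linear_quaternion_Im)
  have nth: "(\<lambda>q::quaternion. q $ i) differentiable (at q)" for i
    by (intro bounded_linear_imp_differentiable bounded_linear_vec_nth)
  have real: "(\<lambda>q. complex_of_real (f q)) differentiable (at q)"
    if "f differentiable (at q)" for f :: "quaternion \<Rightarrow> real"
    using differentiable_chain_at[of f q complex_of_real] that
    by (simp add: comp_def bounded_linear_imp_differentiable bounded_linear_of_real)
  have "complex_of_real (norm (quaternion_Im q) + q $ 3) \<noteq> 0"
    using assms unfolding of_real_eq_0_iff by (simp add: north_domain_def)
  then have 1: "(\<lambda>q. Complex (q $ 1) (q $ 2) / of_real (norm (quaternion_Im q) + q $ 3))
      differentiable (at q)"
    unfolding Complex_eq
    by (intro differentiable_divide differentiable_add differentiable_mult differentiable_const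
        real n nth)
  have 2: "(\<lambda>q. Complex (q $ 0) (norm (quaternion_Im q))) differentiable (at q)"
    unfolding Complex_eq
    by (intro differentiable_add differentiable_mult differentiable_const real n nth)
  fix i :: 2
  show "(\<lambda>q. north_coords q $ i) differentiable (at q)"
    using exhaust_2[of i] 1 2 unfolding north_coords_def by (auto simp only: vector_2)
qed

section \<open>Cauchy-Riemann equations for the inverse chart\<close>

text \<open>The differential of inverse stereographic projection intertwines multiplication by \<open>\<i>\<close>
  with the rotation \<open>v \<mapsto> I \<times> v\<close> of the tangent plane at \<open>I = (a, b, c)\<close>.\<close>

lemma sphere_tangent_rotation:
  fixes x y P \<xi> \<eta> :: real
  assumes P: "P * (1 + x * x + y * y) = 1"
  defines "a \<equiv> 2 * x * P" and "b \<equiv> 2 * y * P" and "c \<equiv> 2 * P - 1"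
    and "k \<equiv> - (2 * (x * \<xi> + y * \<eta>) * P * P)" and "l \<equiv> - (2 * (y * \<xi> - x * \<eta>) * P * P)"
  shows "a * a + b * b + c * c = 1"
    and "a * (2 * \<xi> * P + 2 * x * k) + b * (2 * \<eta> * P + 2 * y * k) + c * (2 * k) = 0"
    and "b * (2 * k) - c * (2 * \<eta> * P + 2 * y * k) = - 2 * \<eta> * P + 2 * x * l"
    and "c * (2 * \<xi> * P + 2 * x * k) - a * (2 * k) = 2 * \<xi> * P + 2 * y * l"
    and "a * (2 * \<eta> * P + 2 * y * k) - b * (2 * \<xi> * P + 2 * x * k) = 2 * l"
proof -
  \<comment> \<open>Here \<open>k\<close> and \<open>l\<close> are the derivatives of P along \<xi>
    + i\<eta> and along i (\<xi> + i\<eta>) = -\<eta> + i\<xi>. In this identity the terms with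
    \<open>k\<close> cancel; the other four hold modulo the relation between P, x and y.\<close>
  show "a * (2 * \<eta> * P + 2 * y * k) - b * (2 * \<xi> * P + 2 * x * k) = 2 * l"
    by (simp add: a_def b_def k_def l_def algebra_simps)
qed (use P in \<open>unfold a_def b_def c_def k_def l_def, algebra+\<close>)

text \<open>The product rule in each component, with \<open>k h\<close> as the derivative of P in
  the direction \<open>h\<close>.\<close>

lemma north_inverse_derivative:
  fixes w :: "complex^2"
  defines "x \<equiv> Re (w $ 1)" and "y \<equiv> Im (w $ 1)" and "r \<equiv> Im (w $ 2)"
  defines "P \<equiv> inverse (1 + x * x + y * y)"
  defines "k \<equiv> \<lambda>h :: complex^2. - (2 * (x * Re (h $ 1) + y * Im (h $ 1)) * P * P)"
  shows "(north_inverse has_derivative (\<lambda>h. vec4 (Re (h $ 2))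
      (Im (h $ 2) * (2 * x * P) + r * (2 * Re (h $ 1) * P + 2 * x * k h))
      (Im (h $ 2) * (2 * y * P) + r * (2 * Im (h $ 1) * P + 2 * y * k h))
      (Im (h $ 2) * (2 * P - 1) + r * (2 * k h)))) (at w)"
    (is "(_ has_derivative ?E) _")
proof (rule has_derivative_vec_componentwise)
  have re: "((\<lambda>w::complex^2. Re (w $ i)) has_derivative (\<lambda>h. Re (h $ i))) (at w)" for i
    by (intro bounded_linear_imp_has_derivative bounded_linear_compose[OF bounded_linear_Re]
        bounded_linear_vec_nth)
  have im: "((\<lambda>w::complex^2. Im (w $ i)) has_derivative (\<lambda>h. Im (h $ i))) (at w)" for i
    by (intro bounded_linear_imp_has_derivative bounded_linear_compose[OF bounded_linear_Im]
        bounded_linear_vec_nth)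
  have nz: "1 + x * x + y * y \<noteq> 0" using one_plus_squares_pos[of x y] by simp
  have N: "((\<lambda>w::complex^2. 1 + Re (w $ 1) * Re (w $ 1) + Im (w $ 1) * Im (w $ 1)) has_derivative
     (\<lambda>h. 2 * (x * Re (h $ 1) + y * Im (h $ 1)))) (at w)"
    by (rule derivative_eq_intros re im refl)+ (simp add: x_def y_def algebra_simps)
  have dP: "((\<lambda>w::complex^2. inverse (1 + Re (w $ 1) * Re (w $ 1) + Im (w $ 1) * Im (w $ 1)))
      has_derivative k) (at w)"
    by (rule has_derivative_eq_rhs[OF Deriv.has_derivative_inverse[OF _ N]])
       (use nz in \<open>auto simp: k_def P_def x_def y_def fun_eq_iff\<close>)
  have P: "inverse (1 + Re (w $ 1) * Re (w $ 1) + Im (w $ 1) * Im (w $ 1)) = P"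
    by (simp add: P_def x_def y_def)
  have "((\<lambda>w. Im (w $ 2) * (2 * Re (w $ 1) * inverse (1 + Re (w $ 1) * Re (w $ 1) + Im (w $ 1) * Im (w $ 1))))
      has_derivative (\<lambda>h. ?E h $ 1)) (at w)"
    by (rule has_derivative_eq_rhs,
        (rule dP re im has_derivative_mult has_derivative_diff has_derivative_const)+)
       (unfold P, simp add: x_def r_def fun_eq_iff algebra_simps)
  moreover have "((\<lambda>w. Im (w $ 2) * (2 * Im (w $ 1) * inverse (1 + Re (w $ 1) * Re (w $ 1) + Im (w $ 1) * Im (w $ 1))))
      has_derivative (\<lambda>h. ?E h $ 2)) (at w)"
    by (rule has_derivative_eq_rhs,
        (rule dP re im has_derivative_mult has_derivative_diff has_derivative_const)+)
       (unfold P, simp add: y_def r_def fun_eq_iff algebra_simps)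
  moreover have "((\<lambda>w. Im (w $ 2) * (2 * inverse (1 + Re (w $ 1) * Re (w $ 1) + Im (w $ 1) * Im (w $ 1)) - 1))
      has_derivative (\<lambda>h. ?E h $ 3)) (at w)"
    by (rule has_derivative_eq_rhs,
        (rule dP re im has_derivative_mult has_derivative_diff has_derivative_const)+)
       (unfold P, simp add: r_def fun_eq_iff algebra_simps)
  ultimately have "\<forall>i. ((\<lambda>x. north_inverse x $ i) has_derivative (\<lambda>h. ?E h $ i)) (at w)"
    unfolding forall_0123 north_inverse_def Let_def vec4_nth using re by blast
  then show "((\<lambda>x. north_inverse x $ i) has_derivative (\<lambda>h. ?E h $ i)) (at w)" for i ..
qed

text \<open>Grouped so that, for I = (a, b, c), the real part -I . Im q and the vector part q0 I + I
  x Im q can be read off.\<close>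

lemma quaternion_mult_imaginary:
  "vec4 0 a b c \<star> q = vec4 (- (a * q $ 1 + b * q $ 2 + c * q $ 3)) (a * q $ 0 + (b * q $ 3 - c * q $ 2))
     (b * q $ 0 + (c * q $ 1 - a * q $ 3)) (c * q $ 0 + (a * q $ 2 - b * q $ 1))"
  by (simp add: quaternion_mult_def vec_eq_iff forall_0123)

text \<open>The derivative has the form E v = s + t I + r T with T = (A, B, C) tangent to the sphere
  at I. Left multiplication by I gives -t + s I + r (I x T), because I . T = 0. The pair (-t, s)
  belongs to i (s + it), and I x T is the tangent vector belonging to i times the first
  coordinate.\<close>

lemma north_inverse_holomorphic:
  assumes w: "w \<in> coords_range"
  shows "\<exists>E. (north_inverse has_derivative E) (at w) \<and>
    (\<forall>v. E (\<i> *s v) = JJ (north_inverse w) (E v))"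
proof (intro exI conjI allI)
  define x y r where d: "x = Re (w $ 1)" "y = Im (w $ 1)" "r = Im (w $ 2)"
  define P where "P = inverse (1 + x * x + y * y)"
  have P: "P * (1 + x * x + y * y) = 1"
    using one_plus_squares_pos[of x y] by (simp add: P_def)
  define k where "k h = - (2 * (x * Re (h $ 1) + y * Im (h $ 1)) * P * P)" for h :: "complex^2"
  define E where "E h = vec4 (Re (h $ 2))
      (Im (h $ 2) * (2 * x * P) + r * (2 * Re (h $ 1) * P + 2 * x * k h))
      (Im (h $ 2) * (2 * y * P) + r * (2 * Im (h $ 1) * P + 2 * y * k h))
      (Im (h $ 2) * (2 * P - 1) + r * (2 * k h))" for h :: "complex^2"
  show "(north_inverse has_derivative E) (at w)"
    unfolding E_def k_def P_def d by (rule north_inverse_derivative)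
  fix v :: "complex^2"
  have I: "imaginary_unit (north_inverse w) = vec4 0 (2 * x * P) (2 * y * P) (2 * P - 1)"
    unfolding imaginary_unit_north_inverse[OF w] Let_def P_def d ..
  define s t \<xi> \<eta> where v: "s = Re (v $ 2)" "t = Im (v $ 2)" "\<xi> = Re (v $ 1)" "\<eta> = Im (v $ 1)"
  define a b c where abc: "a = 2 * x * P" "b = 2 * y * P" "c = 2 * P - 1"
  define A B C where ABC: "A = 2 * \<xi> * P + 2 * x * k v" "B = 2 * \<eta> * P + 2 * y * k v" "C = 2 * k v"
  have kv: "k v = - (2 * (x * \<xi> + y * \<eta>) * P * P)" by (simp add: k_def v)
  have kiv: "k (\<i> *s v) = - (2 * (y * \<xi> - x * \<eta>) * P * P)" by (simp add: k_def v)
  note rot = sphere_tangent_rotation(1)[OF P, folded abc]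
    sphere_tangent_rotation(2-5)[OF P, where \<xi> = \<xi> and \<eta> = \<eta>, folded kv kiv, folded abc, folded ABC]
  have Ev: "E v = vec4 s (t * a + r * A) (t * b + r * B) (t * c + r * C)"
    by (simp add: E_def v abc ABC)
  have "JJ (north_inverse w) (E v) = vec4 (- (t * (a * a + b * b + c * c) + r * (a * A + b * B + c * C)))
     (s * a + r * (b * C - c * B)) (s * b + r * (c * A - a * C)) (s * c + r * (a * B - b * A))"
    unfolding JJ_def I abc[symmetric] quaternion_mult_imaginary Ev
    by (simp add: vec_eq_iff forall_0123 algebra_simps)
  also have "\<dots> = vec4 (- t) (s * a + r * (- 2 * \<eta> * P + 2 * x * k (\<i> *s v)))
     (s * b + r * (2 * \<xi> * P + 2 * y * k (\<i> *s v))) (s * c + r * (2 * k (\<i> *s v)))"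
    unfolding rot by simp
  also have "\<dots> = E (\<i> *s v)" by (simp add: E_def v abc)
  finally show "E (\<i> *s v) = JJ (north_inverse w) (E v)" ..
qed

section \<open>The second chart and the overlap\<close>

text \<open>Conjugation by \<open>i\<close>, an automorphism of the quaternions that swaps the poles.\<close>

definition flip :: "quaternion \<Rightarrow> quaternion"
  where "flip q = vec4 (q $ 0) (q $ 1) (- q $ 2) (- q $ 3)"

lemma flip_nth [simp]:
  "flip q $ 0 = q $ 0" "flip q $ 1 = q $ 1" "flip q $ 2 = - q $ 2" "flip q $ 3 = - q $ 3"
  by (simp_all add: flip_def)

lemma flip_flip [simp]: "flip (flip q) = q"
  by (simp add: vec_eq_iff forall_0123)

lemma bounded_linear_flip: "bounded_linear flip"
  unfolding linear_conv_bounded_linear[symmetric]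
  by (rule linearI) (simp_all add: vec_eq_iff forall_0123)

lemma norm_Im_flip [simp]: "norm (quaternion_Im (flip q)) = norm (quaternion_Im q)"
  by (simp add: norm_quaternion_Im)

lemma flip_JJ: "flip (JJ q v) = JJ (flip q) (flip v)"
proof -
  have "imaginary_unit (flip q) = flip (imaginary_unit q)"
    unfolding imaginary_unit_def norm_Im_flip by (simp add: vec_eq_iff forall_0123)
  then show ?thesis
    by (simp add: JJ_def quaternion_mult_def vec_eq_iff forall_0123)
qed

definition south_domain :: "quaternion set"
  where "south_domain = flip -` north_domain"

text \<open>The first coordinate is (b - ic) / (r - e); the sign of c keeps the chart holomorphic.
  Everything about it follows from the first chart, because \<open>flip\<close> commutes with
  \<open>JJ\<close>.\<close>

definition south_coords :: "quaternion \<Rightarrow> complex^2"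
  where "south_coords q = north_coords (flip q)"

lemma north_chart: "(north_domain, north_coords) \<in> nonreal_atlas"
  unfolding nonreal_atlas_def
  by (rule almost_complex_atlasI[where \<theta> = north_inverse and V = coords_range])
     (fact open_north_domain north_domain_nonreal open_coords_range | erule north_inverse_coords
       north_coords_inverse differentiable_north_coords north_inverse_holomorphic)+

lemma south_chart: "(south_domain, south_coords) \<in> nonreal_atlas"
  unfolding nonreal_atlas_def
proof (rule almost_complex_atlasI[where \<theta> = "flip \<circ> north_inverse" and V = coords_range])
  show "open south_domain"
    unfolding south_domain_def
    by (intro open_vimage open_north_domain linear_continuous_on bounded_linear_flip)
  show "south_domain \<subseteq> - real_quaternions"
    using north_domain_nonreal by (auto simp: south_domain_def real_quaternions_iff)
  show "open coords_range" by (fact open_coords_range)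
next
  fix q assume "q \<in> south_domain"
  then have q: "flip q \<in> north_domain" by (simp add: south_domain_def)
  then show "south_coords q \<in> coords_range" "(flip \<circ> north_inverse) (south_coords q) = q"
    by (simp_all add: south_coords_def north_inverse_coords)
  show "south_coords differentiable (at q)"
    using differentiable_chain_at[OF bounded_linear_imp_differentiable[OF bounded_linear_flip]
        differentiable_north_coords[OF q]]
    by (simp add: comp_def south_coords_def[abs_def])
next
  fix w assume w: "w \<in> coords_range"
  then show "(flip \<circ> north_inverse) w \<in> south_domain" "south_coords ((flip \<circ> north_inverse) w) = w"
    by (simp_all add: south_domain_def south_coords_def north_coords_inverse)
  obtain E where E: "(north_inverse has_derivative E) (at w)"
    "\<forall>v. E (\<i> *s v) = JJ (north_inverse w) (E v)"
    using north_inverse_holomorphic[OF w] by blast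
  have "(flip \<circ> north_inverse has_derivative flip \<circ> E) (at w)"
    using E(1) by (rule diff_chain_at) (rule bounded_linear_imp_has_derivative[OF bounded_linear_flip])
  then show "\<exists>E. (flip \<circ> north_inverse has_derivative E) (at w) \<and>
      (\<forall>v. E (\<i> *s v) = JJ ((flip \<circ> north_inverse) w) (E v))"
    using E(2) by (intro exI[of _ "flip \<circ> E"]) (simp add: flip_JJ)
qed

lemma nonreal_cover:
  assumes "q \<notin> real_quaternions" shows "q \<in> north_domain \<or> q \<in> south_domain"
proof -
  have "norm (quaternion_Im q) > 0" using assms by (simp add: real_quaternions_iff)
  then have "0 < norm (quaternion_Im q) + q $ 3 \<or> 0 < norm (quaternion_Im q) - q $ 3" by linarith
  then show ?thesis by (simp add: north_domain_def south_domain_def)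
qed

lemma complex_manifold_nonreal: "complex_manifold nonreal_topology nonreal_atlas"
  unfolding nonreal_topology_def nonreal_atlas_def
proof (rule almost_complex_manifold, rule subsetI)
  fix q assume "q \<in> - real_quaternions"
  then show "q \<in> (\<Union>c\<in>almost_complex_atlas (- real_quaternions) JJ. fst (c :: (quaternion, 2) chart))"
    using nonreal_cover[of q] north_chart south_chart unfolding nonreal_atlas_def by fastforce
qed

text \<open>Outside the south domain r \<le> e, and r^2 = b^2 + c^2 + e^2 forces b = c = 0. The
  vanishing coordinate will show up as a vanishing homogeneous coordinate.\<close>

lemma coords_pole:
  assumes "q \<notin> south_domain" shows "north_coords q $ 1 = 0"
proof -
  have "norm (quaternion_Im q) \<le> q $ 3"
    using assms by (simp add: south_domain_def north_domain_def)
  then have "(norm (quaternion_Im q))\<^sup>2 \<le> (q $ 3)\<^sup>2" by (intro power_mono) auto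
  then have "(q $ 1)\<^sup>2 + (q $ 2)\<^sup>2 \<le> 0" by (simp add: norm_quaternion_Im_square)
  then have "q $ 1 = 0" "q $ 2 = 0" by (simp_all add: sum_power2_le_zero_iff)
  then show ?thesis by (simp add: north_coords_def vector_2 complex_eq_iff)
qed

text \<open>The change of coordinates u |-> 1/u: the product of the numerators is b^2 + c^2, that of
  the denominators (r + e) (r - e), and these agree by the sphere equation.\<close>

lemma coords_overlap:
  assumes "q \<in> north_domain" "q \<in> south_domain"
  shows "north_coords q $ 1 * south_coords q $ 1 = 1" "north_coords q $ 2 = south_coords q $ 2"
proof -
  define r b c e where d: "r = norm (quaternion_Im q)" "b = q $ 1" "c = q $ 2" "e = q $ 3"
  have "r + e > 0" "r - e > 0"
    using assms by (simp_all add: north_domain_def south_domain_def d)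
  then have nz: "(r + e) * (r - e) \<noteq> 0" by simp
  have "r\<^sup>2 = b\<^sup>2 + c\<^sup>2 + e\<^sup>2" by (simp add: d norm_quaternion_Im_square)
  then have "b * b + c * c = (r + e) * (r - e)" by (simp add: power2_eq_square algebra_simps)
  then have 1: "Complex b c * Complex b (- c) = of_real ((r + e) * (r - e))"
    by (simp add: complex_eq_iff)
  have "north_coords q $ 1 * south_coords q $ 1 =
      (Complex b c * Complex b (- c)) / of_real ((r + e) * (r - e))"
    by (simp add: north_coords_def south_coords_def vector_2 d)
  also have "\<dots> = 1" unfolding 1 using nz by (simp del: of_real_mult)
  finally show "north_coords q $ 1 * south_coords q $ 1 = 1" .
  show "north_coords q $ 2 = south_coords q $ 2"
    by (simp add: north_coords_def south_coords_def vector_2)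
qed

section \<open>The quadric\<close>

text \<open>Affine coordinates corrected so that the third one vanishes exactly on the quadric.\<close>

definition chart0_coords :: "complex^4 \<Rightarrow> complex^3"
  where "chart0_coords Z = vector [Z $ 1 / Z $ 0, Z $ 2 / Z $ 0, Z $ 3 / Z $ 0 - Z $ 1 / Z $ 0 * (Z $ 2 / Z $ 0)]"

text \<open>The second coordinate is \<open>Z $ 3 / Z $ 1\<close> since it equals
  \<open>Z $ 2 / Z $ 0\<close> on the quadric where both are defined: it is v in both
  charts.\<close>

definition chart1_coords :: "complex^4 \<Rightarrow> complex^3"
  where "chart1_coords Z = vector [Z $ 0 / Z $ 1, Z $ 3 / Z $ 1, Z $ 2 / Z $ 1 - Z $ 0 / Z $ 1 * (Z $ 3 / Z $ 1)]"

definition chart0_section :: "complex^3 \<Rightarrow> complex^4"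
  where "chart0_section w = vec4 1 (w $ 1) (w $ 2) (w $ 3 + w $ 1 * w $ 2)"

definition chart1_section :: "complex^3 \<Rightarrow> complex^4"
  where "chart1_section w = vec4 (w $ 1) 1 (w $ 3 + w $ 1 * w $ 2) (w $ 2)"

lemma section_chart0: "section_chart {Z. Z $ 0 \<noteq> 0} chart0_coords chart0_section"
  unfolding section_chart_def
proof (intro conjI ballI allI impI)
  show "holomorphic_vec_on chart0_coords {Z. Z $ 0 \<noteq> 0}"
  proof (rule holomorphic_vec_on_componentwise)
    fix Z :: "complex^4" and i :: 3
    assume "Z \<in> {Z. Z $ 0 \<noteq> 0}"
    then show "complex_differentiable_at (\<lambda>Z. chart0_coords Z $ i) Z"
      using exhaust_3[of i] unfolding chart0_coords_def
      by (auto intro!: holo_intros simp: vector_3)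
  qed
  show "holomorphic_vec_on chart0_section UNIV"
    unfolding chart0_section_def vec4_def
    by (rule holomorphic_vec_on_componentwise, simp only: vec_lambda_beta, intro holo_intros)
next
  fix Z :: "complex^4" assume "Z \<in> {Z. Z $ 0 \<noteq> 0}"
  then show "\<exists>c. c \<noteq> 0 \<and> Z = c *s chart0_section (chart0_coords Z)"
    by (intro exI[of _ "Z $ 0"])
       (simp add: vec_eq_iff forall_0123 chart0_coords_def chart0_section_def vector_3)
qed (auto simp: open_nonzero_component vec_eq_iff forall_3 vector_3 chart0_coords_def chart0_section_def)

lemma section_chart1: "section_chart {Z. Z $ 1 \<noteq> 0} chart1_coords chart1_section"
  unfolding section_chart_def
proof (intro conjI ballI allI impI)
  show "holomorphic_vec_on chart1_coords {Z. Z $ 1 \<noteq> 0}"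
  proof (rule holomorphic_vec_on_componentwise)
    fix Z :: "complex^4" and i :: 3
    assume "Z \<in> {Z. Z $ 1 \<noteq> 0}"
    then show "complex_differentiable_at (\<lambda>Z. chart1_coords Z $ i) Z"
      using exhaust_3[of i] unfolding chart1_coords_def
      by (auto intro!: holo_intros simp: vector_3)
  qed
  show "holomorphic_vec_on chart1_section UNIV"
    unfolding chart1_section_def vec4_def
    by (rule holomorphic_vec_on_componentwise, simp only: vec_lambda_beta, intro holo_intros)
next
  fix Z :: "complex^4" assume "Z \<in> {Z. Z $ 1 \<noteq> 0}"
  then show "\<exists>c. c \<noteq> 0 \<and> Z = c *s chart1_section (chart1_coords Z)"
    by (intro exI[of _ "Z $ 1"])
       (simp add: vec_eq_iff forall_0123 chart1_coords_def chart1_section_def vector_3)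
qed (auto simp: open_nonzero_component vec_eq_iff forall_3 vector_3 chart1_coords_def chart1_section_def)

text \<open>The section inverts the chart, so flatness along the hypersurface with cone
  \<open>K\<close> is a condition on the section alone.\<close>

lemma section_chart_flat:
  fixes F :: "complex^'m::finite \<Rightarrow> complex^3"
  assumes S: "section_chart C F s"
    and K: "\<And>Z c. Z \<in> K \<Longrightarrow> c \<noteq> 0 \<Longrightarrow> c *s Z \<in> K" and flat: "\<And>w. s w \<in> K \<longleftrightarrow> w $ 3 = 0"
  shows "(\<lambda>p. F (SOME Z. Z \<in> p)) ` (homogeneous ` C \<inter> homogeneous ` K) =
    (\<lambda>p. F (SOME Z. Z \<in> p)) ` homogeneous ` C \<inter> {w. w $ 3 = 0}"
proof (intro subset_antisym subsetI)
  note mem = homogeneous_in_image_iff[of K, OF K]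
  have s: "s w \<in> C" "F (s w) = w" for w using S by (auto simp: section_chart_def)
  {
    fix w assume "w \<in> (\<lambda>p. F (SOME Z. Z \<in> p)) ` (homogeneous ` C \<inter> homogeneous ` K)"
    then obtain Z where Z: "Z \<in> C" "homogeneous Z \<in> homogeneous ` K" "w = F Z"
      using section_chart_coordinates[OF S] by auto
    then have "homogeneous (s w) \<in> homogeneous ` K"
      using section_chart_section[OF S] by simp
    then have "w $ 3 = 0" using mem flat by blast
    moreover have "w \<in> (\<lambda>p. F (SOME Z. Z \<in> p)) ` homogeneous ` C"
      using Z section_chart_coordinates[OF S Z(1)] by (intro image_eqI[of _ _ "homogeneous Z"]) auto
    ultimately show "w \<in> (\<lambda>p. F (SOME Z. Z \<in> p)) ` homogeneous ` C \<inter> {w. w $ 3 = 0}"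
      by blast
  next
    fix w assume "w \<in> (\<lambda>p. F (SOME Z. Z \<in> p)) ` homogeneous ` C \<inter> {w. w $ 3 = 0}"
    then have "s w \<in> K" using flat by blast
    then show "w \<in> (\<lambda>p. F (SOME Z. Z \<in> p)) ` (homogeneous ` C \<inter> homogeneous ` K)"
      using s[of w] section_chart_coordinates[OF S, of "s w"]
      by (intro image_eqI[of _ _ "homogeneous (s w)"]) auto
  }
qed

section \<open>The open subset of the quadric\<close>

text \<open>The quadric equation is left out to make this an open cone; \<open>quadric_plus\<close>
  is its trace on the quadric.\<close>

definition quadric_plus_cone :: "(complex^4) set"
  where "quadric_plus_cone = {Z. Z $ 0 \<noteq> 0 \<and> Z $ 2 / Z $ 0 \<in> upper_half_plane} \<union>
    {Z. Z $ 1 \<noteq> 0 \<and> Z $ 3 / Z $ 1 \<in> upper_half_plane}"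

lemma quadric_mem_iff:
  "homogeneous Z \<in> quadric \<longleftrightarrow> Z \<noteq> 0 \<and> Z $ 0 * Z $ 3 = Z $ 1 * Z $ 2"
  unfolding quadric_def by (subst homogeneous_in_image_iff) auto

lemma quadric_plus_mem_iff:
  "homogeneous Z \<in> quadric_plus \<longleftrightarrow> Z $ 0 * Z $ 3 = Z $ 1 * Z $ 2 \<and> Z \<in> quadric_plus_cone"
  unfolding quadric_plus_def quadric_plus_cone_def
  by (subst homogeneous_in_image_iff) auto

lemma quadric_plus_points: "quadric_plus \<subseteq> quadric" "quadric \<subseteq> projective_points"
  by (auto simp: quadric_plus_def quadric_def projective_points_def)

lemma quadric_plus_cases:
  assumes "p \<in> quadric_plus"
  obtains Z where "p = homogeneous Z"
  using assms unfolding quadric_plus_def by blast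

lemma open_quadric_plus_cone: "open quadric_plus_cone"
proof -
  have "open {Z :: complex^4. Z $ i \<noteq> 0 \<and> Z $ j / Z $ i \<in> upper_half_plane}" for i j
  proof -
    have "open ({Z :: complex^4. Z $ i \<noteq> 0} \<inter> (\<lambda>Z. Z $ j / Z $ i) -` upper_half_plane)"
      by (intro continuous_open_preimage open_nonzero_component continuous_intros)
         (auto simp: upper_half_plane_def intro!: open_Collect_less continuous_intros)
    then show ?thesis by (simp add: Int_def)
  qed
  then show ?thesis unfolding quadric_plus_cone_def by (intro open_Un)
qed

lemma openin_quadric_plus: "openin (subtopology projective_space quadric) quadric_plus"
proof -
  have mem: "homogeneous Z \<in> homogeneous ` quadric_plus_cone \<longleftrightarrow> Z \<in> quadric_plus_cone" for Z
    unfolding quadric_plus_cone_def by (intro homogeneous_in_image_iff) auto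
  have nz: "0 \<notin> quadric_plus_cone" by (simp add: quadric_plus_cone_def)
  have "{Z. Z \<noteq> 0 \<and> homogeneous Z \<in> homogeneous ` quadric_plus_cone} = quadric_plus_cone"
    using nz mem by auto
  moreover have "homogeneous ` quadric_plus_cone \<subseteq> projective_points"
    using nz by (auto simp: projective_points_def)
  ultimately have "openin projective_space (homogeneous ` quadric_plus_cone)"
    by (simp add: openin_projective_space open_quadric_plus_cone)
  moreover have "quadric_plus = homogeneous ` quadric_plus_cone \<inter> quadric"
  proof (intro subset_antisym subsetI)
    fix p assume p: "p \<in> quadric_plus"
    then obtain Z where "p = homogeneous Z" by (rule quadric_plus_cases)
    with p show "p \<in> homogeneous ` quadric_plus_cone \<inter> quadric"
      using quadric_plus_points(1) by (auto simp: quadric_plus_mem_iff)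
  qed (auto simp: quadric_plus_mem_iff quadric_mem_iff)
  ultimately show ?thesis by (auto simp: openin_subtopology)
qed

section \<open>The slice atlas of the open subset\<close>

lemma quadric_plus_atlas_cases:
  assumes "c \<in> quadric_plus_atlas"
  obtains W \<phi> where "c = (W \<inter> quadric \<inter> quadric_plus, plane_part \<circ> \<phi>)"
    "(W, \<phi>) \<in> maximal_atlas projective_space CP3_atlas"
    "\<phi> ` (W \<inter> quadric) = \<phi> ` W \<inter> {w. w $ 3 = 0}"
  using assms unfolding quadric_plus_atlas_def open_submanifold_atlas_def quadric_atlas_def slice_atlas_eq
  by auto

lemma quadric_plus_is_chart:
  assumes "c \<in> quadric_plus_atlas"
  shows "is_chart quadric_plus_topology c"
  using assms
proof (rule quadric_plus_atlas_cases)
  fix W \<phi> assume c: "c = (W \<inter> quadric \<inter> quadric_plus, plane_part \<circ> \<phi>)"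
    "(W, \<phi>) \<in> maximal_atlas projective_space CP3_atlas"
    "\<phi> ` (W \<inter> quadric) = \<phi> ` W \<inter> {w. w $ 3 = 0}"
  have "is_chart projective_space (W, \<phi>)" using c(2) by (simp add: maximal_atlas_def)
  from is_chart_slice[OF this c(3) openin_quadric_plus] show ?thesis
    by (simp add: c(1) quadric_plus_topology_def)
qed

lemma quadric_plus_compatible:
  assumes "c \<in> quadric_plus_atlas" "d \<in> quadric_plus_atlas"
  shows "compatible_charts c d"
proof -
  obtain W \<phi> where c: "c = (W \<inter> quadric \<inter> quadric_plus, plane_part \<circ> \<phi>)"
    "(W, \<phi>) \<in> maximal_atlas projective_space CP3_atlas"
    "\<phi> ` (W \<inter> quadric) = \<phi> ` W \<inter> {w. w $ 3 = 0}"
    using assms(1) by (rule quadric_plus_atlas_cases)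
  obtain V \<psi> where d: "d = (V \<inter> quadric \<inter> quadric_plus, plane_part \<circ> \<psi>)"
    "(V, \<psi>) \<in> maximal_atlas projective_space CP3_atlas"
    "\<psi> ` (V \<inter> quadric) = \<psi> ` V \<inter> {w. w $ 3 = 0}"
    using assms(2) by (rule quadric_plus_atlas_cases)
  note trans = maximal_atlas_transition[OF CP3_atlas_cover, OF _ c(2) d(2), OF CP3_atlas_is_chart]
    maximal_atlas_transition[OF CP3_atlas_cover, OF _ d(2) c(2), OF CP3_atlas_is_chart]
  have charts: "is_chart projective_space (W, \<phi>)" "is_chart projective_space (V, \<psi>)"
    using c d by (auto simp: maximal_atlas_def)
  show ?thesis
    unfolding c(1) d(1) compatible_charts_def prod.case
    using slice_transition[OF charts(1) c(3) charts(2) d(3) openin_quadric_plus trans(1)]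
      slice_transition[OF charts(2) d(3) charts(1) c(3) openin_quadric_plus trans(2)]
    by (simp add: Int_commute)
qed

lemma flat_chart_in_quadric_plus_atlas:
  assumes S: "section_chart C F s"
    and flat: "\<And>w. homogeneous (s w) \<in> quadric \<longleftrightarrow> w $ 3 = 0"
  shows "(homogeneous ` C \<inter> quadric \<inter> quadric_plus, plane_part \<circ> (\<lambda>p. F (SOME Z. Z \<in> p)))
    \<in> quadric_plus_atlas"
proof -
  have "(\<lambda>p. F (SOME Z. Z \<in> p)) ` (homogeneous ` C \<inter> quadric) =
      (\<lambda>p. F (SOME Z. Z \<in> p)) ` homogeneous ` C \<inter> {w. w $ 3 = 0}"
    unfolding quadric_def
    by (rule section_chart_flat[OF S]) (use flat in \<open>auto simp: quadric_mem_iff\<close>)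
  then have "(homogeneous ` C \<inter> quadric, plane_part \<circ> (\<lambda>p. F (SOME Z. Z \<in> p))) \<in> quadric_atlas"
    using section_chart_in_maximal_atlas[OF S]
    unfolding quadric_atlas_def slice_atlas_eq chart_of_section_def by blast
  then show ?thesis
    unfolding quadric_plus_atlas_def open_submanifold_atlas_def by (force simp: image_iff)
qed

section \<open>Explicit coordinates on the two affine parts\<close>

text \<open>Written exactly as the domain of a restricted slice, so that the charts below are
  literally elements of \<open>quadric_plus_atlas\<close>.\<close>

definition affine_part :: "4 \<Rightarrow> (complex^4) set set"
  where "affine_part j = homogeneous ` {Z. Z $ j \<noteq> 0} \<inter> quadric \<inter> quadric_plus"

definition quadric_coords0 :: "(complex^4) set \<Rightarrow> complex^2"
  where "quadric_coords0 = plane_part \<circ> (\<lambda>p. chart0_coords (SOME Z. Z \<in> p))"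

definition quadric_coords1 :: "(complex^4) set \<Rightarrow> complex^2"
  where "quadric_coords1 = plane_part \<circ> (\<lambda>p. chart1_coords (SOME Z. Z \<in> p))"

lemma quadric_chart0: "(affine_part 0, quadric_coords0) \<in> quadric_plus_atlas"
  unfolding affine_part_def quadric_coords0_def
  by (rule flat_chart_in_quadric_plus_atlas[OF section_chart0])
     (simp add: quadric_mem_iff chart0_section_def vec_eq_iff forall_0123)

lemma quadric_chart1: "(affine_part 1, quadric_coords1) \<in> quadric_plus_atlas"
  unfolding affine_part_def quadric_coords1_def
  by (rule flat_chart_in_quadric_plus_atlas[OF section_chart1])
     (simp add: quadric_mem_iff chart1_section_def vec_eq_iff forall_0123)

lemma affine_part_mem_iff:
  "homogeneous Z \<in> affine_part j \<longleftrightarrow>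
    Z $ j \<noteq> 0 \<and> Z $ 0 * Z $ 3 = Z $ 1 * Z $ 2 \<and> Z \<in> quadric_plus_cone"
proof -
  have "homogeneous Z \<in> homogeneous ` {Z. Z $ j \<noteq> 0} \<longleftrightarrow> Z $ j \<noteq> 0"
    by (subst homogeneous_in_image_iff) auto
  then show ?thesis
    by (auto simp: affine_part_def quadric_mem_iff quadric_plus_mem_iff)
qed

lemma quadric_coords0_homogeneous:
  "Z $ 0 \<noteq> 0 \<Longrightarrow> quadric_coords0 (homogeneous Z) = vector [Z $ 1 / Z $ 0, Z $ 2 / Z $ 0]"
  using section_chart_coordinates[OF section_chart0, of Z]
  by (simp add: quadric_coords0_def plane_part_def chart0_coords_def vector_3)

lemma quadric_coords1_homogeneous:
  "Z $ 1 \<noteq> 0 \<Longrightarrow> quadric_coords1 (homogeneous Z) = vector [Z $ 0 / Z $ 1, Z $ 3 / Z $ 1]"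
  using section_chart_coordinates[OF section_chart1, of Z]
  by (simp add: quadric_coords1_def plane_part_def chart1_coords_def vector_3)

definition quadric_point0 :: "complex^2 \<Rightarrow> (complex^4) set"
  where "quadric_point0 w = homogeneous (vec4 1 (w $ 1) (w $ 2) (w $ 1 * w $ 2))"

definition quadric_point1 :: "complex^2 \<Rightarrow> (complex^4) set"
  where "quadric_point1 w = homogeneous (vec4 (w $ 1) 1 (w $ 1 * w $ 2) (w $ 2))"

lemma quadric_coords0_point:
  assumes "w \<in> coords_range"
  shows "quadric_point0 w \<in> affine_part 0" "quadric_coords0 (quadric_point0 w) = w"
proof -
  show "quadric_point0 w \<in> affine_part 0"
    using assms unfolding quadric_point0_def affine_part_mem_iff
    by (simp add: quadric_plus_cone_def coords_range_def)
  show "quadric_coords0 (quadric_point0 w) = w"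
    unfolding quadric_point0_def
    by (subst quadric_coords0_homogeneous) (simp_all add: vec_eq_iff forall_2 vector_2)
qed

lemma quadric_coords1_point:
  assumes "w \<in> coords_range"
  shows "quadric_point1 w \<in> affine_part 1" "quadric_coords1 (quadric_point1 w) = w"
proof -
  show "quadric_point1 w \<in> affine_part 1"
    using assms unfolding quadric_point1_def affine_part_mem_iff
    by (simp add: quadric_plus_cone_def coords_range_def)
  show "quadric_coords1 (quadric_point1 w) = w"
    unfolding quadric_point1_def
    by (subst quadric_coords1_homogeneous) (simp_all add: vec_eq_iff forall_2 vector_2)
qed

lemma affine_part_cases:
  assumes "p \<in> affine_part j"
  obtains Z where "p = homogeneous Z" "Z $ j \<noteq> 0" "Z $ 0 * Z $ 3 = Z $ 1 * Z $ 2" "Z \<in> quadric_plus_cone"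
proof -
  obtain Z where "p = homogeneous Z" using assms by (auto simp: affine_part_def)
  with assms that show ?thesis by (simp add: affine_part_mem_iff)
qed

text \<open>Where both ratios exist, the quadric equation makes them equal, so whichever alternative
  defines the point, the other ratio lies in the half plane too.\<close>

lemma quadric_plus_cone_slope:
  assumes "Z \<in> quadric_plus_cone" "Z $ 0 * Z $ 3 = Z $ 1 * Z $ 2"
  shows "Z $ 0 \<noteq> 0 \<Longrightarrow> Z $ 2 / Z $ 0 \<in> upper_half_plane"
    and "Z $ 1 \<noteq> 0 \<Longrightarrow> Z $ 3 / Z $ 1 \<in> upper_half_plane"
proof -
  have "Z $ 3 / Z $ 1 = Z $ 2 / Z $ 0" if "Z $ 0 \<noteq> 0" "Z $ 1 \<noteq> 0"
    unfolding frac_eq_eq[OF that(2,1)] using assms(2) by (metis mult.commute)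
  then show "Z $ 0 \<noteq> 0 \<Longrightarrow> Z $ 2 / Z $ 0 \<in> upper_half_plane"
    and "Z $ 1 \<noteq> 0 \<Longrightarrow> Z $ 3 / Z $ 1 \<in> upper_half_plane"
    using assms(1) unfolding quadric_plus_cone_def Un_iff mem_Collect_eq by metis+
qed

lemma quadric_coords0_range:
  assumes "p \<in> affine_part 0" shows "quadric_coords0 p \<in> coords_range"
  using assms
proof (rule affine_part_cases)
  fix Z :: "complex^4"
  assume Z: "p = homogeneous Z" "Z $ 0 \<noteq> 0" "Z $ 0 * Z $ 3 = Z $ 1 * Z $ 2" "Z \<in> quadric_plus_cone"
  show ?thesis
    using quadric_plus_cone_slope(1)[OF Z(4,3,2)]
    by (simp add: Z(1) quadric_coords0_homogeneous[OF Z(2)] coords_range_def vector_2)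
qed

lemma quadric_coords1_range:
  assumes "p \<in> affine_part 1" shows "quadric_coords1 p \<in> coords_range"
  using assms
proof (rule affine_part_cases)
  fix Z :: "complex^4"
  assume Z: "p = homogeneous Z" "Z $ 1 \<noteq> 0" "Z $ 0 * Z $ 3 = Z $ 1 * Z $ 2" "Z \<in> quadric_plus_cone"
  show ?thesis
    using quadric_plus_cone_slope(2)[OF Z(4,3,2)]
    by (simp add: Z(1) quadric_coords1_homogeneous[OF Z(2)] coords_range_def vector_2)
qed

lemma affine_parts_cover: "quadric_plus = affine_part 0 \<union> affine_part 1"
proof (intro subset_antisym subsetI)
  fix p assume p: "p \<in> quadric_plus"
  then obtain Z where "p = homogeneous Z" by (rule quadric_plus_cases)
  with p show "p \<in> affine_part 0 \<union> affine_part 1"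
    unfolding Un_iff by (simp add: quadric_plus_mem_iff affine_part_mem_iff) (auto simp: quadric_plus_cone_def)
qed (auto simp: affine_part_def)

lemma quadric_points_eq:
  assumes "u $ 1 * w $ 1 = 1" "u $ 2 = w $ 2"
  shows "quadric_point0 u = quadric_point1 w"
proof -
  have "u $ 1 \<noteq> 0" using assms(1) by auto
  \<comment> \<open>The representatives [1, u, v, uv] and [1/u, 1, v/u, v] differ by the factor
    u.\<close>
  moreover have "vec4 1 (u $ 1) (u $ 2) (u $ 1 * u $ 2) = u $ 1 *s vec4 (w $ 1) 1 (w $ 1 * w $ 2) (w $ 2)"
    using assms by (simp add: vec_eq_iff forall_0123 mult.assoc[symmetric])
  ultimately show ?thesis
    unfolding quadric_point0_def quadric_point1_def by (simp add: homogeneous_scale)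
qed

section \<open>The biholomorphism\<close>

text \<open>Nonreal quaternions outside the north domain lie in the south one; at real quaternions
  the second branch gives a meaningless default.\<close>

definition twistor_map :: "quaternion \<Rightarrow> (complex^4) set"
  where "twistor_map q = (if q \<in> north_domain then quadric_point0 (north_coords q)
    else quadric_point1 (south_coords q))"

lemma twistor_map_north: "q \<in> north_domain \<Longrightarrow> twistor_map q = quadric_point0 (north_coords q)"
  by (simp add: twistor_map_def)

lemma twistor_map_south: "q \<in> south_domain \<Longrightarrow> twistor_map q = quadric_point1 (south_coords q)"
  using coords_overlap quadric_points_eq by (auto simp: twistor_map_def)

lemma north_coords_range: "q \<in> north_domain \<Longrightarrow> north_coords q \<in> coords_range"
  and south_coords_range: "q \<in> south_domain \<Longrightarrow> south_coords q \<in> coords_range"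
  by (simp_all add: north_inverse_coords south_domain_def south_coords_def)

lemma twistor_map_coords0:
  assumes "q \<in> north_domain"
  shows "twistor_map q \<in> affine_part 0" "quadric_coords0 (twistor_map q) = north_coords q"
  using quadric_coords0_point[OF north_coords_range[OF assms]] assms
  by (simp_all add: twistor_map_north)

lemma twistor_map_coords1:
  assumes "q \<in> south_domain"
  shows "twistor_map q \<in> affine_part 1" "quadric_coords1 (twistor_map q) = south_coords q"
  using quadric_coords1_point[OF south_coords_range[OF assms]] assms
  by (simp_all add: twistor_map_south)

text \<open>Outside the north domain the imaginary unit is the south pole, where the coordinate 1/u
  and with it the homogeneous coordinate Z0 vanish.\<close>

lemma twistor_map_north_iff:
  assumes "q \<notin> real_quaternions" "twistor_map q \<in> affine_part 0" shows "q \<in> north_domain"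
proof (rule ccontr)
  assume "q \<notin> north_domain"
  then have "q \<in> south_domain" "south_coords q $ 1 = 0"
    using assms(1) nonreal_cover coords_pole[of "flip q"]
    by (auto simp: south_coords_def south_domain_def)
  then show False
    using assms(2) by (simp add: twistor_map_south quadric_point1_def affine_part_mem_iff)
qed

lemma twistor_map_south_iff:
  assumes "q \<notin> real_quaternions" "twistor_map q \<in> affine_part 1" shows "q \<in> south_domain"
proof (rule ccontr)
  assume "q \<notin> south_domain"
  then have "q \<in> north_domain" "north_coords q $ 1 = 0"
    using assms(1) nonreal_cover coords_pole[of q] by auto
  then show False
    using assms(2) by (simp add: twistor_map_north quadric_point0_def affine_part_mem_iff)
qed

lemma inj_quadric_coords0: "inj_on quadric_coords0 (affine_part 0)"
  using quadric_plus_is_chart[OF quadric_chart0] by (simp add: is_chart_iff)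

lemma inj_quadric_coords1: "inj_on quadric_coords1 (affine_part 1)"
  using quadric_plus_is_chart[OF quadric_chart1] by (simp add: is_chart_iff)

lemma inj_north_coords: "inj_on north_coords north_domain"
  and inj_south_coords: "inj_on south_coords south_domain"
  using north_chart south_chart by (simp_all add: nonreal_atlas_def almost_complex_atlas_def)

text \<open>The chart domains correspond exactly under the map, and on each pair both coordinates
  are injective with the same image \<open>coords_range\<close>.\<close>

lemma twistor_map_bij: "bij_betw twistor_map (- real_quaternions) quadric_plus"
  unfolding bij_betw_def
proof
  show "inj_on twistor_map (- real_quaternions)"
  proof (rule inj_onI)
    fix p q assume pq: "p \<in> - real_quaternions" "q \<in> - real_quaternions" "twistor_map p = twistor_map q"
    show "p = q"
    proof (cases "p \<in> north_domain")
      case True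
      then have "q \<in> north_domain"
        using twistor_map_coords0(1)[OF True] twistor_map_north_iff[of q] pq by simp
      then show ?thesis
        using True pq(3) twistor_map_coords0(2) inj_north_coords by (metis inj_onD)
    next
      case False
      then have p: "p \<in> south_domain" using nonreal_cover pq(1) by auto
      then have "q \<in> south_domain"
        using twistor_map_coords1(1)[OF p] twistor_map_south_iff[of q] pq by simp
      then show ?thesis
        using p pq(3) twistor_map_coords1(2) inj_south_coords by (metis inj_onD)
    qed
  qed
  show "twistor_map ` (- real_quaternions) = quadric_plus"
  proof (intro subset_antisym subsetI)
    fix y assume "y \<in> twistor_map ` (- real_quaternions)"
    then show "y \<in> quadric_plus"
      using nonreal_cover twistor_map_coords0(1) twistor_map_coords1(1)
      unfolding affine_parts_cover by blast
  next
    fix y assume "y \<in> quadric_plus"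
    then consider "y \<in> affine_part 0" | "y \<in> affine_part 1" unfolding affine_parts_cover by blast
    then show "y \<in> twistor_map ` (- real_quaternions)"
    proof cases
      case 1
      let ?q = "north_inverse (quadric_coords0 y)"
      have q: "?q \<in> north_domain" "north_coords ?q = quadric_coords0 y"
        using north_coords_inverse[OF quadric_coords0_range[OF 1]] by auto
      then have "twistor_map ?q = y"
        using twistor_map_coords0[OF q(1)] inj_quadric_coords0 1 by (metis inj_onD)
      then show ?thesis using q(1) north_domain_nonreal by blast
    next
      case 2
      let ?q = "flip (north_inverse (quadric_coords1 y))"
      have q: "?q \<in> south_domain" "south_coords ?q = quadric_coords1 y"
        using north_coords_inverse[OF quadric_coords1_range[OF 2]]
        by (auto simp: south_domain_def south_coords_def)
      then have "twistor_map ?q = y"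
        using twistor_map_coords1[OF q(1)] inj_quadric_coords1 2 by (metis inj_onD)
      moreover have "?q \<notin> real_quaternions"
        using q(1) south_chart by (auto simp: nonreal_atlas_def almost_complex_atlas_def)
      ultimately show ?thesis by blast
    qed
  qed
qed

lemma twistor_map_matches_charts:
  assumes "q \<in> topspace nonreal_topology"
  shows "\<exists>U \<phi> V \<psi>. (U, \<phi>) \<in> nonreal_atlas \<and> (V, \<psi>) \<in> quadric_plus_atlas \<and>
    q \<in> U \<and> twistor_map ` U \<subseteq> V \<and> (\<forall>x\<in>U. \<psi> (twistor_map x) = \<phi> x)"
proof -
  have "q \<notin> real_quaternions" using assms by (simp add: nonreal_topology_def)
  then consider "q \<in> north_domain" | "q \<in> south_domain" using nonreal_cover by blast
  then show ?thesis
  proof cases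
    case 1
    then show ?thesis
      using north_chart quadric_chart0 twistor_map_coords0 by (metis image_subsetI)
  next
    case 2
    then show ?thesis
      using south_chart quadric_chart1 twistor_map_coords1 by (metis image_subsetI)
  qed
qed

lemma topspace_quadric_plus: "topspace quadric_plus_topology = quadric_plus"
  using quadric_plus_points by (auto simp: quadric_plus_topology_def)

text \<open>Points of an affine part come from the corresponding quaternionic domain, so the inverse
  also is the identity in the same charts, and its holomorphy follows as for the map itself.\<close>

lemma inverse_twistor_map_matches_charts:
  defines "g \<equiv> inv_into (- real_quaternions) twistor_map"
  assumes "y \<in> topspace quadric_plus_topology"
  shows "\<exists>V \<psi> U \<phi>. (V, \<psi>) \<in> quadric_plus_atlas \<and> (U, \<phi>) \<in> nonreal_atlas \<and>
    y \<in> V \<and> g ` V \<subseteq> U \<and> (\<forall>x\<in>V. \<phi> (g x) = \<psi> x)"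
proof -
  have g: "g x \<notin> real_quaternions" "twistor_map (g x) = x" if "x \<in> quadric_plus" for x
    using that twistor_map_bij inv_into_into[of x twistor_map "- real_quaternions"]
    by (auto simp: g_def bij_betw_def f_inv_into_f)
  have 0: "g x \<in> north_domain" "north_coords (g x) = quadric_coords0 x" if "x \<in> affine_part 0" for x
    using that g[of x] twistor_map_north_iff[of "g x"] twistor_map_coords0(2)[of "g x"]
    by (auto simp: affine_parts_cover)
  have 1: "g x \<in> south_domain" "south_coords (g x) = quadric_coords1 x" if "x \<in> affine_part 1" for x
    using that g[of x] twistor_map_south_iff[of "g x"] twistor_map_coords1(2)[of "g x"]
    by (auto simp: affine_parts_cover)
  consider "y \<in> affine_part 0" | "y \<in> affine_part 1"
    using assms(2) by (auto simp: topspace_quadric_plus affine_parts_cover)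
  then show ?thesis
  proof cases
    case 1
    then show ?thesis using 0 north_chart quadric_chart0 by (metis image_subsetI)
  next
    case 2
    then show ?thesis using 1 south_chart quadric_chart1 by (metis image_subsetI)
  qed
qed

text \<open>On the quadric side only the chart property enters, so there is no circularity in
  deriving the manifold property from this homeomorphism.\<close>

lemma nonreal_homeomorphic_quadric_plus: "nonreal_topology homeomorphic_space quadric_plus_topology"
proof -
  have charts: "is_chart nonreal_topology c" if "c \<in> nonreal_atlas" for c
    using complex_manifold_nonreal that by (simp add: complex_manifold_def)
  have "homeomorphic_maps nonreal_topology quadric_plus_topology twistor_map
      (inv_into (- real_quaternions) twistor_map)"
    unfolding homeomorphic_maps_def
  proof (intro conjI ballI)
    show "continuous_map nonreal_topology quadric_plus_topology twistor_map"
      by (rule continuous_map_matching_charts[OF charts quadric_plus_is_chart twistor_map_matches_charts])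
    show "continuous_map quadric_plus_topology nonreal_topology (inv_into (- real_quaternions) twistor_map)"
      by (rule continuous_map_matching_charts[OF quadric_plus_is_chart charts inverse_twistor_map_matches_charts])
  qed (use twistor_map_bij in \<open>auto simp: nonreal_topology_def topspace_quadric_plus bij_betw_def f_inv_into_f\<close>)
  then show ?thesis by (auto simp: homeomorphic_space_def)
qed

text \<open>The Hausdorff property and second countability are transported from the quaternions.\<close>

lemma complex_manifold_quadric_plus: "complex_manifold quadric_plus_topology quadric_plus_atlas"
  unfolding complex_manifold_def
proof (intro conjI ballI)
  show "Hausdorff_space quadric_plus_topology" "second_countable quadric_plus_topology"
    using complex_manifold_nonreal homeomorphic_Hausdorff_space[OF nonreal_homeomorphic_quadric_plus]
      homeomorphic_space_second_countability[OF nonreal_homeomorphic_quadric_plus]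
    by (simp_all add: complex_manifold_def)
  show "(\<Union>c\<in>quadric_plus_atlas. fst c) = topspace quadric_plus_topology"
  proof
    show "(\<Union>c\<in>quadric_plus_atlas. fst c) \<subseteq> topspace quadric_plus_topology"
      by (auto simp: topspace_quadric_plus elim!: quadric_plus_atlas_cases)
    show "topspace quadric_plus_topology \<subseteq> (\<Union>c\<in>quadric_plus_atlas. fst c)"
      unfolding topspace_quadric_plus affine_parts_cover
      using quadric_chart0 quadric_chart1 by force
  qed
qed (fact quadric_plus_is_chart | rule quadric_plus_is_chart quadric_plus_compatible, assumption+)+

theorem proposition5p1:
  shows "complex_manifold nonreal_topology nonreal_atlas \<and>
    openin (subtopology projective_space quadric) quadric_plus \<and>
    complex_manifold quadric_plus_topology quadric_plus_atlas \<and>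
    biholomorphic nonreal_topology nonreal_atlas quadric_plus_topology quadric_plus_atlas"
proof (intro conjI)
  show "biholomorphic nonreal_topology nonreal_atlas quadric_plus_topology quadric_plus_atlas"
    unfolding biholomorphic_def
  proof (intro exI conjI ballI)
    show "holomorphic_mapping nonreal_topology nonreal_atlas quadric_plus_topology quadric_plus_atlas twistor_map"
      by (rule holomorphic_mapping_matching_charts[OF complex_manifold_nonreal
            complex_manifold_quadric_plus twistor_map_matches_charts])
    show "holomorphic_mapping quadric_plus_topology quadric_plus_atlas nonreal_topology nonreal_atlas
        (inv_into (- real_quaternions) twistor_map)"
      by (rule holomorphic_mapping_matching_charts[OF complex_manifold_quadric_plus
            complex_manifold_nonreal inverse_twistor_map_matches_charts])
  qed (use twistor_map_bij in \<open>auto simp: nonreal_topology_def topspace_quadric_plus bij_betw_def f_inv_into_f\<close>)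
qed (fact complex_manifold_nonreal openin_quadric_plus complex_manifold_quadric_plus)+

end
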